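(* Let $\mathbb{D}$ be a fibrant double category with stable local countable coproducts. Then the forgetful functor $U\colon\mathsf{Mnd}(\mathbb{D})\to\mathsf{End}(\mathbb{D})$ has a left adjoint.
   Context: A (pseudo) double category $\mathbb{D}$ consists of a category $\mathbb{D}_0$ (objects: 0-cells; morphisms: vertical 1-cells), a category $\mathbb{D}_1$ (objects: horizontal 1-cells; morphisms: 2-cells), and functors $\mathbf{1}\colon\mathbb{D}_0\to\mathbb{D}_1$, $X\mapsto 1_X$, $f\mapsto 1_f$ (units), $\mathfrak{s},\mathfrak{t}\colon\mathbb{D}_1\to\mathbb{D}_0$ (source, target), $\odot\colon\mathbb{D}_1\times_{\mathbb{D}_0}\mathbb{D}_1\to\mathbb{D}_1$ (horizontal composition; $M\odot N$ is defined when $\mathfrak{s}(M)=\mathfrak{t}(N)$), with $\mathfrak{s}(1_X)=\mathfrak{t}(1_X)=X$, $\mathfrak{s}(M\odot N)=\mathfrak{s}(N)$, $\mathfrak{t}(M\odot N)=\mathfrak{t}(M)$ (and likewise on morphisms), together with natural associativity and left/right unit isomorphisms for $\odot$ and $\mathbf{1}$ in $\mathbb{D}_1$ whose images under $\mathfrak{s}$ and $\mathfrak{t}$ are identities, satisfying the usual coherence conditions. A horizontal 1-cell $M$ with $\mathfrak{s}(M)=X$, $\mathfrak{t}(M)=Y$ is written $M\colon X\to Y$. A 2-cell $\alpha$ is globular if $\mathfrak{s}(\alpha)$ and $\mathfrak{t}(\alpha)$ are identities. $\mathbb{D}[X,Y]$ denotes the category of horizontal 1-cells $X\to Y$ and globular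 2-cells. $\mathbb{D}$ is fibrant if $\langle\mathfrak{s},\mathfrak{t}\rangle\colon\mathbb{D}_1\to\mathbb{D}_0\times\mathbb{D}_0$ is a (Grothendieck) fibration, equivalently an opfibration. $\mathsf{End}(\mathbb{D})$ is the subcategory of $\mathbb{D}_1$ given by the equalizer of $\mathfrak{s},\mathfrak{t}$: objects are horizontal endo-1-cells $M\colon X\to X$, morphisms are 2-cells $\alpha$ with $\mathfrak{s}(\alpha)=\mathfrak{t}(\alpha)$. A monad in $\mathbb{D}$ is a horizontal endo-1-cell $A\colon X\to X$ with globular 2-cells $\mu\colon A\odot A\Rightarrow A$, $\eta\colon 1_X\Rightarrow A$ satisfying the usual associativity and unit laws. A monad morphism from $A\colon X\to X$ to $B\colon Y\to Y$ is a 2-cell $\alpha\colon A\Rightarrow B$ with $\mathfrak{s}(\alpha)=\mathfrak{t}(\alpha)=f\colon X\to Y$ such that $\mu_B(\alpha\odot\alpha)=\alpha\mu_A$ and $\alpha\eta_A=\eta_B 1_f$. These form the category $\mathsf{Mnd}(\mathbb{D})$, and $U$ forgets $\mu,\eta$. For a small category $\mathcal{I}$, $\mathbb{D}$ has stable local $\mathcal{I}$-colimits if every $\mathbb{D}[X,Y]$ has $\mathcal{I}$-colimits and these are preserved by the functors $M\odot-\colon\mathbb{D}[Z,X]\to\mathbb{D}[Z,Y]$ and $-\odot M\colon\mathbb{D}[Y,Z]\to\mathbb{D}[X,Z]$ for every $M\colon X\to Y$ and every 0-cell $Z$; by convention the phrase also includes the assumption that $\mathbb{D}_0$ has $\mathcal{I}$-colimits.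 Stable local countable coproducts is the case of countable discrete $\mathcal{I}$. *)

theory Defs
  imports Main
begin

section \<open>Categories, functors, adjunctions\<close>

text \<open>Everything is carrier-based: operations are only meaningful on the sets \<open>Obj\<close> and \<open>Arr\<close>,
  and their values elsewhere are unspecified. Composition is written in applicative order.\<close>

record ('o, 'm) cat =
  Obj :: "'o set"
  Arr :: "'m set"
  Dom :: "'m \<Rightarrow> 'o"
  Cod :: "'m \<Rightarrow> 'o"
  Idn :: "'o \<Rightarrow> 'm"
  Comp :: "'m \<Rightarrow> 'm \<Rightarrow> 'm"  (infixr "\<cdot>\<index>" 70)

definition in_hom :: "('o, 'm) cat \<Rightarrow> 'm \<Rightarrow> 'o \<Rightarrow> 'o \<Rightarrow> bool" where
  "in_hom C f x y \<longleftrightarrow> f \<in> Arr C \<and> Dom C f = x \<and> Cod C f = y"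

locale category =
  fixes C :: "('o, 'm) cat"
  assumes Dom_Obj: "f \<in> Arr C \<Longrightarrow> Dom C f \<in> Obj C"
    and Cod_Obj: "f \<in> Arr C \<Longrightarrow> Cod C f \<in> Obj C"
    and Idn_hom: "x \<in> Obj C \<Longrightarrow> in_hom C (Idn C x) x x"
    and Comp_hom: "in_hom C f x y \<Longrightarrow> in_hom C g y z \<Longrightarrow> in_hom C (g \<cdot>\<^bsub>C\<^esub> f) x z"
    and Comp_Idn_left: "in_hom C f x y \<Longrightarrow> Idn C y \<cdot>\<^bsub>C\<^esub> f = f"
    and Comp_Idn_right: "in_hom C f x y \<Longrightarrow> f \<cdot>\<^bsub>C\<^esub> Idn C x = f"
    and Comp_assoc: "in_hom C f w x \<Longrightarrow> in_hom C g x y \<Longrightarrow> in_hom C h y z \<Longrightarrow>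
      (h \<cdot>\<^bsub>C\<^esub> g) \<cdot>\<^bsub>C\<^esub> f = h \<cdot>\<^bsub>C\<^esub> (g \<cdot>\<^bsub>C\<^esub> f)"

definition is_iso :: "('o, 'm) cat \<Rightarrow> 'm \<Rightarrow> bool" where
  "is_iso C f \<longleftrightarrow> f \<in> Arr C \<and>
    (\<exists>g. in_hom C g (Cod C f) (Dom C f) \<and>
         g \<cdot>\<^bsub>C\<^esub> f = Idn C (Dom C f) \<and> f \<cdot>\<^bsub>C\<^esub> g = Idn C (Cod C f))"

record ('o, 'm, 'p, 'n) fctr =
  omap :: "'o \<Rightarrow> 'p"
  amap :: "'m \<Rightarrow> 'n"

locale is_functor = C: category C + E: category E
  for C :: "('o, 'm) cat" and E :: "('p, 'n) cat" +
  fixes F :: "('o, 'm, 'p, 'n) fctr"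
  assumes omap_Obj: "x \<in> Obj C \<Longrightarrow> omap F x \<in> Obj E"
    and amap_hom: "in_hom C f x y \<Longrightarrow> in_hom E (amap F f) (omap F x) (omap F y)"
    and amap_Idn: "x \<in> Obj C \<Longrightarrow> amap F (Idn C x) = Idn E (omap F x)"
    and amap_Comp: "in_hom C f x y \<Longrightarrow> in_hom C g y z \<Longrightarrow>
      amap F (g \<cdot>\<^bsub>C\<^esub> f) = amap F g \<cdot>\<^bsub>E\<^esub> amap F f"

definition id_fctr :: "('o, 'm, 'o, 'm) fctr" where
  "id_fctr = \<lparr>omap = (\<lambda>x. x), amap = (\<lambda>f. f)\<rparr>"

definition comp_fctr ::
  "('p, 'n, 'q, 'k) fctr \<Rightarrow> ('o, 'm, 'p, 'n) fctr \<Rightarrow> ('o, 'm, 'q, 'k) fctr" where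
  "comp_fctr G F = \<lparr>omap = omap G \<circ> omap F, amap = amap G \<circ> amap F\<rparr>"

definition nat_trans :: "('o, 'm) cat \<Rightarrow> ('p, 'n) cat \<Rightarrow>
    ('o, 'm, 'p, 'n) fctr \<Rightarrow> ('o, 'm, 'p, 'n) fctr \<Rightarrow> ('o \<Rightarrow> 'n) \<Rightarrow> bool" where
  "nat_trans C E F G \<tau> \<longleftrightarrow> is_functor C E F \<and> is_functor C E G \<and>
    (\<forall>x\<in>Obj C. in_hom E (\<tau> x) (omap F x) (omap G x)) \<and>
    (\<forall>f\<in>Arr C. \<tau> (Cod C f) \<cdot>\<^bsub>E\<^esub> amap F f = amap G f \<cdot>\<^bsub>E\<^esub> \<tau> (Dom C f))"

text \<open>\<open>adjunction C E F U \<eta> \<epsilon>\<close> says that \<open>F : C \<rightarrow> E\<close> is left adjoint to \<open>U : E \<rightarrow> C\<close>,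
  with unit \<open>\<eta>\<close> and counit \<open>\<epsilon>\<close>.\<close>

definition adjunction :: "('o, 'm) cat \<Rightarrow> ('p, 'n) cat \<Rightarrow> ('o, 'm, 'p, 'n) fctr \<Rightarrow>
    ('p, 'n, 'o, 'm) fctr \<Rightarrow> ('o \<Rightarrow> 'm) \<Rightarrow> ('p \<Rightarrow> 'n) \<Rightarrow> bool" where
  "adjunction C E F U \<eta> \<epsilon> \<longleftrightarrow>
    is_functor C E F \<and> is_functor E C U \<and>
    nat_trans C C id_fctr (comp_fctr U F) \<eta> \<and>
    nat_trans E E (comp_fctr F U) id_fctr \<epsilon> \<and>
    (\<forall>c\<in>Obj C. \<epsilon> (omap F c) \<cdot>\<^bsub>E\<^esub> amap F (\<eta> c) = Idn E (omap F c)) \<and>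
    (\<forall>e\<in>Obj E. amap U (\<epsilon> e) \<cdot>\<^bsub>C\<^esub> \<eta> (omap U e) = Idn C (omap U e))"

definition has_left_adjoint ::
  "('p, 'n) cat \<Rightarrow> ('o, 'm) cat \<Rightarrow> ('p, 'n, 'o, 'm) fctr \<Rightarrow> bool" where
  "has_left_adjoint E C U \<longleftrightarrow> (\<exists>F \<eta> \<epsilon>. adjunction C E F U \<eta> \<epsilon>)"


section \<open>Products, pullbacks, fibrations\<close>

definition prod_cat :: "('o, 'm) cat \<Rightarrow> ('p, 'n) cat \<Rightarrow> ('o \<times> 'p, 'm \<times> 'n) cat" where
  "prod_cat B C = \<lparr>
    Obj = Obj B \<times> Obj C,
    Arr = Arr B \<times> Arr C,
    Dom = map_prod (Dom B) (Dom C),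
    Cod = map_prod (Cod B) (Cod C),
    Idn = map_prod (Idn B) (Idn C),
    Comp = (\<lambda>(g, g') (f, f'). (g \<cdot>\<^bsub>B\<^esub> f, g' \<cdot>\<^bsub>C\<^esub> f'))\<rparr>"

definition pair_fctr ::
  "('o, 'm, 'p, 'n) fctr \<Rightarrow> ('o, 'm, 'q, 'k) fctr \<Rightarrow> ('o, 'm, 'p \<times> 'q, 'n \<times> 'k) fctr" where
  "pair_fctr F G = \<lparr>omap = (\<lambda>x. (omap F x, omap G x)), amap = (\<lambda>f. (amap F f, amap G f))\<rparr>"

text \<open>The strict pullback of \<open>F\<close> and \<open>G\<close>, as a subcategory of the product.\<close>

definition pullback_cat :: "('o, 'm) cat \<Rightarrow> ('p, 'n) cat \<Rightarrow> ('o, 'm, 'q, 'k) fctr \<Rightarrow>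
    ('p, 'n, 'q, 'k) fctr \<Rightarrow> ('o \<times> 'p, 'm \<times> 'n) cat" where
  "pullback_cat B C F G = (prod_cat B C)\<lparr>
    Obj := {(x, y). x \<in> Obj B \<and> y \<in> Obj C \<and> omap F x = omap G y},
    Arr := {(f, g). f \<in> Arr B \<and> g \<in> Arr C \<and> amap F f = amap G g}\<rparr>"

definition cartesian :: "('o, 'm) cat \<Rightarrow> ('p, 'n) cat \<Rightarrow> ('o, 'm, 'p, 'n) fctr \<Rightarrow> 'm \<Rightarrow> bool" where
  "cartesian E B P \<phi> \<longleftrightarrow> \<phi> \<in> Arr E \<and>
    (\<forall>\<psi>\<in>Arr E. \<forall>g\<in>Arr B. Cod E \<psi> = Cod E \<phi> \<and> Cod B g = omap P (Dom E \<phi>) \<and>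
        amap P \<psi> = amap P \<phi> \<cdot>\<^bsub>B\<^esub> g \<longrightarrow>
      (\<exists>!\<chi>. in_hom E \<chi> (Dom E \<psi>) (Dom E \<phi>) \<and> amap P \<chi> = g \<and> \<phi> \<cdot>\<^bsub>E\<^esub> \<chi> = \<psi>))"

definition fibration :: "('o, 'm) cat \<Rightarrow> ('p, 'n) cat \<Rightarrow> ('o, 'm, 'p, 'n) fctr \<Rightarrow> bool" where
  "fibration E B P \<longleftrightarrow> is_functor E B P \<and>
    (\<forall>e\<in>Obj E. \<forall>f\<in>Arr B. Cod B f = omap P e \<longrightarrow>
      (\<exists>\<phi>. cartesian E B P \<phi> \<and> Cod E \<phi> = e \<and> amap P \<phi> = f))"


section \<open>Colimits\<close>

definition cocone :: "('i, 'j) cat \<Rightarrow> ('o, 'm) cat \<Rightarrow> ('i, 'j, 'o, 'm) fctr \<Rightarrow>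
    'o \<Rightarrow> ('i \<Rightarrow> 'm) \<Rightarrow> bool" where
  "cocone I C J c \<iota> \<longleftrightarrow> c \<in> Obj C \<and>
    (\<forall>i\<in>Obj I. in_hom C (\<iota> i) (omap J i) c) \<and>
    (\<forall>u\<in>Arr I. \<iota> (Cod I u) \<cdot>\<^bsub>C\<^esub> amap J u = \<iota> (Dom I u))"

definition is_colimit :: "('i, 'j) cat \<Rightarrow> ('o, 'm) cat \<Rightarrow> ('i, 'j, 'o, 'm) fctr \<Rightarrow>
    'o \<Rightarrow> ('i \<Rightarrow> 'm) \<Rightarrow> bool" where
  "is_colimit I C J c \<iota> \<longleftrightarrow> is_functor I C J \<and> cocone I C J c \<iota> \<and>
    (\<forall>d \<kappa>. cocone I C J d \<kappa> \<longrightarrow>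
      (\<exists>!h. in_hom C h c d \<and> (\<forall>i\<in>Obj I. h \<cdot>\<^bsub>C\<^esub> \<iota> i = \<kappa> i)))"

definition has_colimits :: "('i, 'j) cat \<Rightarrow> ('o, 'm) cat \<Rightarrow> bool" where
  "has_colimits I C \<longleftrightarrow> (\<forall>J. is_functor I C J \<longrightarrow> (\<exists>c \<iota>. is_colimit I C J c \<iota>))"

definition preserves_colimits :: "('i, 'j) cat \<Rightarrow> ('o, 'm) cat \<Rightarrow> ('p, 'n) cat \<Rightarrow>
    ('o, 'm, 'p, 'n) fctr \<Rightarrow> bool" where
  "preserves_colimits I C E F \<longleftrightarrow> (\<forall>J c \<iota>. is_colimit I C J c \<iota> \<longrightarrow>
    is_colimit I E (comp_fctr F J) (omap F c) (\<lambda>i. amap F (\<iota> i)))"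

definition discrete_cat :: "'i set \<Rightarrow> ('i, 'i) cat" where
  "discrete_cat K = \<lparr>Obj = K, Arr = K, Dom = (\<lambda>i. i), Cod = (\<lambda>i. i), Idn = (\<lambda>i. i),
    Comp = (\<lambda>j i. i)\<rparr>"


section \<open>Double categories\<close>

text \<open>Type parameters: \<open>'o\<close> 0-cells, \<open>'v\<close> vertical 1-cells, \<open>'h\<close> horizontal 1-cells,
  \<open>'c\<close> 2-cells.\<close>

record ('o, 'v, 'h, 'c) double_cat =
  D0 :: "('o, 'v) cat"
  D1 :: "('h, 'c) cat"
  HUnit :: "('o, 'v, 'h, 'c) fctr"
  Src :: "('h, 'c, 'o, 'v) fctr"
  Tgt :: "('h, 'c, 'o, 'v) fctr"
  HComp :: "('h \<times> 'h, 'c \<times> 'c, 'h, 'c) fctr"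
  Assoc :: "'h \<Rightarrow> 'h \<Rightarrow> 'h \<Rightarrow> 'c"
  LUnit :: "'h \<Rightarrow> 'c"
  RUnit :: "'h \<Rightarrow> 'c"

abbreviation hcomp1 :: "('o, 'v, 'h, 'c) double_cat \<Rightarrow> 'h \<Rightarrow> 'h \<Rightarrow> 'h"
  (infixr "\<odot>\<index>" 75) where
  "M \<odot>\<^bsub>D\<^esub> N \<equiv> omap (HComp D) (M, N)"

abbreviation hcomp2 :: "('o, 'v, 'h, 'c) double_cat \<Rightarrow> 'c \<Rightarrow> 'c \<Rightarrow> 'c"
  (infixr "\<circledast>\<index>" 75) where
  "\<alpha> \<circledast>\<^bsub>D\<^esub> \<beta> \<equiv> amap (HComp D) (\<alpha>, \<beta>)"

abbreviation hid :: "('o, 'v, 'h, 'c) double_cat \<Rightarrow> 'h \<Rightarrow> 'c" where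
  "hid D \<equiv> Idn (D1 D)"

abbreviation vcomp2 :: "('o, 'v, 'h, 'c) double_cat \<Rightarrow> 'c \<Rightarrow> 'c \<Rightarrow> 'c"
  (infixr "\<bullet>\<index>" 70) where
  "\<beta> \<bullet>\<^bsub>D\<^esub> \<alpha> \<equiv> \<beta> \<cdot>\<^bsub>D1 D\<^esub> \<alpha>"

abbreviation hunit1 :: "('o, 'v, 'h, 'c) double_cat \<Rightarrow> 'o \<Rightarrow> 'h" where
  "hunit1 D \<equiv> omap (HUnit D)"

abbreviation hunit2 :: "('o, 'v, 'h, 'c) double_cat \<Rightarrow> 'v \<Rightarrow> 'c" where
  "hunit2 D \<equiv> amap (HUnit D)"

abbreviation src1 :: "('o, 'v, 'h, 'c) double_cat \<Rightarrow> 'h \<Rightarrow> 'o" where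
  "src1 D \<equiv> omap (Src D)"

abbreviation tgt1 :: "('o, 'v, 'h, 'c) double_cat \<Rightarrow> 'h \<Rightarrow> 'o" where
  "tgt1 D \<equiv> omap (Tgt D)"

abbreviation src2 :: "('o, 'v, 'h, 'c) double_cat \<Rightarrow> 'c \<Rightarrow> 'v" where
  "src2 D \<equiv> amap (Src D)"

abbreviation tgt2 :: "('o, 'v, 'h, 'c) double_cat \<Rightarrow> 'c \<Rightarrow> 'v" where
  "tgt2 D \<equiv> amap (Tgt D)"

text \<open>\<open>M \<odot> N\<close> is defined for \<open>src1 D M = tgt1 D N\<close>, i.e. on the pullback of \<open>Src\<close> and \<open>Tgt\<close>.\<close>

locale double_category =
  fixes D :: "('o, 'v, 'h, 'c) double_cat" (structure)
  assumes Src_functor: "is_functor (D1 D) (D0 D) (Src D)"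
    and Tgt_functor: "is_functor (D1 D) (D0 D) (Tgt D)"
    and HUnit_functor: "is_functor (D0 D) (D1 D) (HUnit D)"
    and HComp_functor:
      "is_functor (pullback_cat (D1 D) (D1 D) (Src D) (Tgt D)) (D1 D) (HComp D)"
    and src1_hunit: "X \<in> Obj (D0 D) \<Longrightarrow> src1 D (hunit1 D X) = X"
    and tgt1_hunit: "X \<in> Obj (D0 D) \<Longrightarrow> tgt1 D (hunit1 D X) = X"
    and src2_hunit: "f \<in> Arr (D0 D) \<Longrightarrow> src2 D (hunit2 D f) = f"
    and tgt2_hunit: "f \<in> Arr (D0 D) \<Longrightarrow> tgt2 D (hunit2 D f) = f"
    and src1_hcomp: "\<lbrakk>M \<in> Obj (D1 D); N \<in> Obj (D1 D); src1 D M = tgt1 D N\<rbrakk> \<Longrightarrow>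
      src1 D (M \<odot> N) = src1 D N"
    and tgt1_hcomp: "\<lbrakk>M \<in> Obj (D1 D); N \<in> Obj (D1 D); src1 D M = tgt1 D N\<rbrakk> \<Longrightarrow>
      tgt1 D (M \<odot> N) = tgt1 D M"
    and src2_hcomp: "\<lbrakk>\<alpha> \<in> Arr (D1 D); \<beta> \<in> Arr (D1 D); src2 D \<alpha> = tgt2 D \<beta>\<rbrakk> \<Longrightarrow>
      src2 D (\<alpha> \<circledast> \<beta>) = src2 D \<beta>"
    and tgt2_hcomp: "\<lbrakk>\<alpha> \<in> Arr (D1 D); \<beta> \<in> Arr (D1 D); src2 D \<alpha> = tgt2 D \<beta>\<rbrakk> \<Longrightarrow>
      tgt2 D (\<alpha> \<circledast> \<beta>) = tgt2 D \<alpha>"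
    and Assoc_hom:
      "\<lbrakk>M \<in> Obj (D1 D); N \<in> Obj (D1 D); P \<in> Obj (D1 D); src1 D M = tgt1 D N; src1 D N = tgt1 D P\<rbrakk> \<Longrightarrow>
      in_hom (D1 D) (Assoc D M N P) ((M \<odot> N) \<odot> P) (M \<odot> (N \<odot> P))"
    and Assoc_iso:
      "\<lbrakk>M \<in> Obj (D1 D); N \<in> Obj (D1 D); P \<in> Obj (D1 D); src1 D M = tgt1 D N; src1 D N = tgt1 D P\<rbrakk> \<Longrightarrow>
      is_iso (D1 D) (Assoc D M N P)"
    and Assoc_natural:
      "\<lbrakk>in_hom (D1 D) \<alpha> M M'; in_hom (D1 D) \<beta> N N'; in_hom (D1 D) \<gamma> P P';
        src2 D \<alpha> = tgt2 D \<beta>; src2 D \<beta> = tgt2 D \<gamma>\<rbrakk> \<Longrightarrow>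
      Assoc D M' N' P' \<bullet> ((\<alpha> \<circledast> \<beta>) \<circledast> \<gamma>) = (\<alpha> \<circledast> (\<beta> \<circledast> \<gamma>)) \<bullet> Assoc D M N P"
    and src2_Assoc:
      "\<lbrakk>M \<in> Obj (D1 D); N \<in> Obj (D1 D); P \<in> Obj (D1 D); src1 D M = tgt1 D N; src1 D N = tgt1 D P\<rbrakk> \<Longrightarrow>
      src2 D (Assoc D M N P) = Idn (D0 D) (src1 D P)"
    and tgt2_Assoc:
      "\<lbrakk>M \<in> Obj (D1 D); N \<in> Obj (D1 D); P \<in> Obj (D1 D); src1 D M = tgt1 D N; src1 D N = tgt1 D P\<rbrakk> \<Longrightarrow>
      tgt2 D (Assoc D M N P) = Idn (D0 D) (tgt1 D M)"
    and LUnit_hom: "M \<in> Obj (D1 D) \<Longrightarrow> in_hom (D1 D) (LUnit D M) (hunit1 D (tgt1 D M) \<odot> M) M"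
    and LUnit_iso: "M \<in> Obj (D1 D) \<Longrightarrow> is_iso (D1 D) (LUnit D M)"
    and LUnit_natural: "in_hom (D1 D) \<alpha> M M' \<Longrightarrow>
      LUnit D M' \<bullet> (hunit2 D (tgt2 D \<alpha>) \<circledast> \<alpha>) = \<alpha> \<bullet> LUnit D M"
    and src2_LUnit: "M \<in> Obj (D1 D) \<Longrightarrow> src2 D (LUnit D M) = Idn (D0 D) (src1 D M)"
    and tgt2_LUnit: "M \<in> Obj (D1 D) \<Longrightarrow> tgt2 D (LUnit D M) = Idn (D0 D) (tgt1 D M)"
    and RUnit_hom: "M \<in> Obj (D1 D) \<Longrightarrow> in_hom (D1 D) (RUnit D M) (M \<odot> hunit1 D (src1 D M)) M"
    and RUnit_iso: "M \<in> Obj (D1 D) \<Longrightarrow> is_iso (D1 D) (RUnit D M)"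
    and RUnit_natural: "in_hom (D1 D) \<alpha> M M' \<Longrightarrow>
      RUnit D M' \<bullet> (\<alpha> \<circledast> hunit2 D (src2 D \<alpha>)) = \<alpha> \<bullet> RUnit D M"
    and src2_RUnit: "M \<in> Obj (D1 D) \<Longrightarrow> src2 D (RUnit D M) = Idn (D0 D) (src1 D M)"
    and tgt2_RUnit: "M \<in> Obj (D1 D) \<Longrightarrow> tgt2 D (RUnit D M) = Idn (D0 D) (tgt1 D M)"
    and pentagon:
      "\<lbrakk>M \<in> Obj (D1 D); N \<in> Obj (D1 D); P \<in> Obj (D1 D); Q \<in> Obj (D1 D);
        src1 D M = tgt1 D N; src1 D N = tgt1 D P; src1 D P = tgt1 D Q\<rbrakk> \<Longrightarrow>
      Assoc D M N (P \<odot> Q) \<bullet> Assoc D (M \<odot> N) P Q =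
      (hid D M \<circledast> Assoc D N P Q) \<bullet> Assoc D M (N \<odot> P) Q \<bullet> (Assoc D M N P \<circledast> hid D Q)"
    and triangle:
      "\<lbrakk>M \<in> Obj (D1 D); N \<in> Obj (D1 D); src1 D M = tgt1 D N\<rbrakk> \<Longrightarrow>
      (hid D M \<circledast> LUnit D N) \<bullet> Assoc D M (hunit1 D (src1 D M)) N = RUnit D M \<circledast> hid D N"

definition globular :: "('o, 'v, 'h, 'c) double_cat \<Rightarrow> 'c \<Rightarrow> bool" where
  "globular D \<alpha> \<longleftrightarrow> \<alpha> \<in> Arr (D1 D) \<and>
    (\<exists>X\<in>Obj (D0 D). src2 D \<alpha> = Idn (D0 D) X) \<and> (\<exists>Y\<in>Obj (D0 D). tgt2 D \<alpha> = Idn (D0 D) Y)"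

definition fibrant :: "('o, 'v, 'h, 'c) double_cat \<Rightarrow> bool" where
  "fibrant D \<longleftrightarrow> fibration (D1 D) (prod_cat (D0 D) (D0 D)) (pair_fctr (Src D) (Tgt D))"

text \<open>The category \<open>D[X, Y]\<close>. The conditions on a 2-cell already fix the source and target
  0-cells of its domain and codomain.\<close>

definition local_cat :: "('o, 'v, 'h, 'c) double_cat \<Rightarrow> 'o \<Rightarrow> 'o \<Rightarrow> ('h, 'c) cat" where
  "local_cat D X Y = (D1 D)\<lparr>
    Obj := {M \<in> Obj (D1 D). src1 D M = X \<and> tgt1 D M = Y},
    Arr := {\<alpha>. globular D \<alpha> \<and> src2 D \<alpha> = Idn (D0 D) X \<and> tgt2 D \<alpha> = Idn (D0 D) Y}\<rparr>"

definition lwhisker :: "('o, 'v, 'h, 'c) double_cat \<Rightarrow> 'h \<Rightarrow> ('h, 'c, 'h, 'c) fctr" where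
  "lwhisker D M = \<lparr>omap = (\<lambda>N. M \<odot>\<^bsub>D\<^esub> N), amap = (\<lambda>\<alpha>. hid D M \<circledast>\<^bsub>D\<^esub> \<alpha>)\<rparr>"

definition rwhisker :: "('o, 'v, 'h, 'c) double_cat \<Rightarrow> 'h \<Rightarrow> ('h, 'c, 'h, 'c) fctr" where
  "rwhisker D M = \<lparr>omap = (\<lambda>N. N \<odot>\<^bsub>D\<^esub> M), amap = (\<lambda>\<alpha>. \<alpha> \<circledast>\<^bsub>D\<^esub> hid D M)\<rparr>"

definition stable_local_colimits :: "('i, 'j) cat \<Rightarrow> ('o, 'v, 'h, 'c) double_cat \<Rightarrow> bool" where
  "stable_local_colimits I D \<longleftrightarrow>
    has_colimits I (D0 D) \<and>
    (\<forall>X\<in>Obj (D0 D). \<forall>Y\<in>Obj (D0 D). has_colimits I (local_cat D X Y)) \<and>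
    (\<forall>X\<in>Obj (D0 D). \<forall>Y\<in>Obj (D0 D). \<forall>Z\<in>Obj (D0 D). \<forall>M\<in>Obj (local_cat D X Y).
      preserves_colimits I (local_cat D Z X) (local_cat D Z Y) (lwhisker D M) \<and>
      preserves_colimits I (local_cat D Y Z) (local_cat D X Z) (rwhisker D M))"

text \<open>Up to bijection, the countable sets (finite ones included) are the sets of natural numbers.\<close>

definition stable_local_countable_coproducts :: "('o, 'v, 'h, 'c) double_cat \<Rightarrow> bool" where
  "stable_local_countable_coproducts D \<longleftrightarrow>
    (\<forall>K :: nat set. stable_local_colimits (discrete_cat K) D)"


section \<open>Endo-1-cells and monads\<close>

definition End_cat :: "('o, 'v, 'h, 'c) double_cat \<Rightarrow> ('h, 'c) cat" where
  "End_cat D = (D1 D)\<lparr>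
    Obj := {M \<in> Obj (D1 D). src1 D M = tgt1 D M},
    Arr := {\<alpha> \<in> Arr (D1 D). src2 D \<alpha> = tgt2 D \<alpha>}\<rparr>"

record ('h, 'c) mnd =
  und :: 'h
  mult :: 'c
  unit :: 'c

definition is_monad :: "('o, 'v, 'h, 'c) double_cat \<Rightarrow> ('h, 'c) mnd \<Rightarrow> bool" where
  "is_monad D T \<longleftrightarrow> (let A = und T; \<mu> = mult T; \<eta> = unit T in
    A \<in> Obj (D1 D) \<and> src1 D A = tgt1 D A \<and>
    globular D \<mu> \<and> in_hom (D1 D) \<mu> (A \<odot>\<^bsub>D\<^esub> A) A \<and>
    globular D \<eta> \<and> in_hom (D1 D) \<eta> (hunit1 D (src1 D A)) A \<and>
    \<mu> \<bullet>\<^bsub>D\<^esub> (\<mu> \<circledast>\<^bsub>D\<^esub> hid D A) = \<mu> \<bullet>\<^bsub>D\<^esub> (hid D A \<circledast>\<^bsub>D\<^esub> \<mu>) \<bullet>\<^bsub>D\<^esub> Assoc D A A A \<and>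
    \<mu> \<bullet>\<^bsub>D\<^esub> (\<eta> \<circledast>\<^bsub>D\<^esub> hid D A) = LUnit D A \<and>
    \<mu> \<bullet>\<^bsub>D\<^esub> (hid D A \<circledast>\<^bsub>D\<^esub> \<eta>) = RUnit D A)"

definition is_monad_morphism ::
  "('o, 'v, 'h, 'c) double_cat \<Rightarrow> ('h, 'c) mnd \<Rightarrow> 'c \<Rightarrow> ('h, 'c) mnd \<Rightarrow> bool" where
  "is_monad_morphism D S \<alpha> T \<longleftrightarrow>
    in_hom (D1 D) \<alpha> (und S) (und T) \<and> src2 D \<alpha> = tgt2 D \<alpha> \<and>
    mult T \<bullet>\<^bsub>D\<^esub> (\<alpha> \<circledast>\<^bsub>D\<^esub> \<alpha>) = \<alpha> \<bullet>\<^bsub>D\<^esub> mult S \<and>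
    \<alpha> \<bullet>\<^bsub>D\<^esub> unit S = unit T \<bullet>\<^bsub>D\<^esub> hunit2 D (src2 D \<alpha>)"

text \<open>An arrow of \<open>Mnd_cat D\<close> carries its domain and codomain, since the 2-cell alone does not
  determine the monad structures.\<close>

definition Mnd_cat :: "('o, 'v, 'h, 'c) double_cat \<Rightarrow>
    (('h, 'c) mnd, ('h, 'c) mnd \<times> 'c \<times> ('h, 'c) mnd) cat" where
  "Mnd_cat D = \<lparr>
    Obj = {T. is_monad D T},
    Arr = {(S, \<alpha>, T). is_monad D S \<and> is_monad D T \<and> is_monad_morphism D S \<alpha> T},
    Dom = (\<lambda>(S, \<alpha>, T). S),
    Cod = (\<lambda>(S, \<alpha>, T). T),
    Idn = (\<lambda>T. (T, hid D (und T), T)),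
    Comp = (\<lambda>(S', \<beta>, T') (S, \<alpha>, T). (S, \<beta> \<bullet>\<^bsub>D\<^esub> \<alpha>, T'))\<rparr>"

definition forget_mnd :: "('o, 'v, 'h, 'c) double_cat \<Rightarrow>
    (('h, 'c) mnd, ('h, 'c) mnd \<times> 'c \<times> ('h, 'c) mnd, 'h, 'c) fctr" where
  "forget_mnd D = \<lparr>omap = und, amap = (\<lambda>(S, \<alpha>, T). \<alpha>)\<rparr>"

end

theory Submission
  imports Defs
begin

text \<open>
  The free monad on an endo-1-cell \<open>M : X \<rightarrow> X\<close> is carried by \<open>T = \<Coprod>\<^sub>n M\<^sup>n\<close>, where
  \<open>M\<^sup>0 = 1\<^sub>X\<close> and \<open>M\<^sup>n\<^sup>+\<^sup>1 = M \<odot> M\<^sup>n\<close>. Describing its multiplication through isomorphisms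
  \<open>M\<^sup>i \<odot> M\<^sup>j \<cong> M\<^sup>i\<^sup>+\<^sup>j\<close> would require coherence arguments by induction on \<open>i\<close>. The proof
  uses the coproduct only once, to establish a recursion principle, and works with that principle
  from then on.

  The inclusion of \<open>M\<^sup>0\<close> is a 2-cell \<open>e : 1\<^sub>X \<Rightarrow> T\<close>, and shifting the summands gives
  \<open>a : M \<odot> T \<Rightarrow> T\<close>. Thus \<open>T\<close> is the free left \<open>M\<close>-action on \<open>1\<^sub>X\<close>; since \<open>- \<odot> N\<close>
  preserves the coproduct, \<open>T \<odot> N\<close> is the free left \<open>M\<close>-action on \<open>N\<close>. Hence a 2-cell \<open>k\<close> out of
  \<open>T \<odot> N\<close> can be defined, and is determined, by \<open>k (e \<odot> N) = z\<close> and
  \<open>k (a \<odot> N) = b (\<alpha> \<odot> k)\<close>, up to the structural constraints, where \<open>\<alpha> : M \<Rightarrow> B\<close> and \<open>b\<close> is an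
  action of \<open>B\<close> on the target of \<open>k\<close>. This is the locale \<open>free_action\<close>. Its instances come
  from \<open>free_action_exists\<close>.

  Fibrancy lets \<open>\<alpha>\<close>, \<open>z\<close> and \<open>k\<close> lie over arbitrary vertical 1-cells, whereas the given coproducts
  are universal only among globular 2-cells: a 2-cell into \<open>Z\<close> over \<open>(v, w)\<close> is the
  same as a globular 2-cell into the domain of a cartesian lift of \<open>(v, w)\<close> to \<open>Z\<close>. This is
  \<open>local_coproduct_is_square_coproduct\<close>.

  The multiplication \<open>\<mu> : T \<odot> T \<Rightarrow> T\<close> is defined by recursion with \<open>z = id\<close> and \<open>b = a\<close>, so the left
  unit law holds by definition. Each of the remaining laws equates two 2-cells out of some \<open>T \<odot> N\<close>
  and follows by checking that both satisfy the same recursion: \<open>N = T \<odot> T\<close> for associativity,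
  \<open>N = 1\<^sub>X\<close> for the right unit law, \<open>N = T\<close> for the multiplicativity of an induced monad morphism.
  The unit coherences that these checks use are \<open>LUnit_hcomp\<close>, \<open>RUnit_hcomp\<close> and \<open>LUnit_hunit\<close>.

  Finally \<open>u : M \<cong> M \<odot> 1\<^sub>X \<Rightarrow> M \<odot> T \<Rightarrow> T\<close> is a universal arrow. A monad morphism \<open>h : T \<Rightarrow> S\<close> with
  \<open>h u = \<alpha>\<close> satisfies \<open>h e = \<eta>\<^sub>S 1\<^sub>f\<close>, and \<open>h a = \<mu>\<^sub>S (\<alpha> \<odot> h)\<close> because \<open>a = \<mu> (u \<odot> T)\<close>. So \<open>h\<close> is
  the unique solution of a recursion; conversely that solution is a monad morphism with
  \<open>h u = \<alpha>\<close> (\<open>free_monad_universal\<close>). Universal arrows assemble into the left adjoint.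
\<close>

section \<open>Typing of composites\<close>

text \<open>Composability is phrased through equations between \<open>Dom\<close>, \<open>Cod\<close>, \<open>src1\<close>, \<open>src2\<close>, and so on, rather
  than through \<open>in_hom\<close>, so that the simplifier can discharge it for large pasting composites.\<close>

context category
begin

lemma Idn_simps [simp]:
  assumes "x \<in> Obj C"
  shows "Idn C x \<in> Arr C" "Dom C (Idn C x) = x" "Cod C (Idn C x) = x"
  using Idn_hom[OF assms] by (auto simp: in_hom_def)

lemma Dom_Cod_Obj [simp]:
  assumes "f \<in> Arr C"
  shows "Dom C f \<in> Obj C" "Cod C f \<in> Obj C"
  using Dom_Obj Cod_Obj assms by auto

lemma Comp_simps [simp]:
  assumes "f \<in> Arr C" "g \<in> Arr C" "Dom C g = Cod C f"
  shows "g \<cdot>\<^bsub>C\<^esub> f \<in> Arr C" "Dom C (g \<cdot>\<^bsub>C\<^esub> f) = Dom C f" "Cod C (g \<cdot>\<^bsub>C\<^esub> f) = Cod C g"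
  using Comp_hom[of f _ _ g] assms by (auto simp: in_hom_def)

lemma Comp_Idn_simps [simp]:
  assumes "f \<in> Arr C"
  shows "Cod C f = x \<Longrightarrow> Idn C x \<cdot>\<^bsub>C\<^esub> f = f" "Dom C f = x \<Longrightarrow> f \<cdot>\<^bsub>C\<^esub> Idn C x = f"
  using Comp_Idn_left[of f] Comp_Idn_right[of f] assms by (auto simp: in_hom_def)

lemma assoc_Arr:
  assumes "f \<in> Arr C" "g \<in> Arr C" "h \<in> Arr C" "Dom C g = Cod C f" "Dom C h = Cod C g"
  shows "(h \<cdot>\<^bsub>C\<^esub> g) \<cdot>\<^bsub>C\<^esub> f = h \<cdot>\<^bsub>C\<^esub> (g \<cdot>\<^bsub>C\<^esub> f)"
  using Comp_assoc assms by (auto simp: in_hom_def)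

lemma iso_cancel_right:
  assumes "is_iso C f" "g \<in> Arr C" "h \<in> Arr C" "Dom C g = Cod C f" "Dom C h = Cod C f"
    and eq: "g \<cdot>\<^bsub>C\<^esub> f = h \<cdot>\<^bsub>C\<^esub> f"
  shows "g = h"
proof -
  obtain k where k: "k \<in> Arr C" "Dom C k = Cod C f" "Cod C k = Dom C f" "f \<cdot>\<^bsub>C\<^esub> k = Idn C (Cod C f)"
    using assms(1) unfolding is_iso_def in_hom_def by auto
  have f: "f \<in> Arr C" using assms(1) by (simp add: is_iso_def)
  have "g = (g \<cdot>\<^bsub>C\<^esub> f) \<cdot>\<^bsub>C\<^esub> k" using assms(2,4) k f by (simp add: assoc_Arr)
  also have "\<dots> = (h \<cdot>\<^bsub>C\<^esub> f) \<cdot>\<^bsub>C\<^esub> k" by (simp only: eq)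
  also have "\<dots> = h" using assms(3,5) k f by (simp add: assoc_Arr)
  finally show ?thesis .
qed

lemma iso_cancel_left:
  assumes "is_iso C f" "g \<in> Arr C" "h \<in> Arr C" "Cod C g = Dom C f" "Cod C h = Dom C f"
    and eq: "f \<cdot>\<^bsub>C\<^esub> g = f \<cdot>\<^bsub>C\<^esub> h"
  shows "g = h"
proof -
  obtain k where k: "k \<in> Arr C" "Dom C k = Cod C f" "Cod C k = Dom C f" "k \<cdot>\<^bsub>C\<^esub> f = Idn C (Dom C f)"
    using assms(1) unfolding is_iso_def in_hom_def by auto
  have f: "f \<in> Arr C" using assms(1) by (simp add: is_iso_def)
  have "g = k \<cdot>\<^bsub>C\<^esub> (f \<cdot>\<^bsub>C\<^esub> g)" using assms(2,4) k f by (simp add: assoc_Arr[symmetric])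
  also have "\<dots> = k \<cdot>\<^bsub>C\<^esub> (f \<cdot>\<^bsub>C\<^esub> h)" by (simp only: eq)
  also have "\<dots> = h" using assms(3,5) k f by (simp add: assoc_Arr[symmetric])
  finally show ?thesis .
qed

end

lemma (in is_functor) functor_simps [simp]:
  shows "x \<in> Obj C \<Longrightarrow> omap F x \<in> Obj E"
    and "f \<in> Arr C \<Longrightarrow> amap F f \<in> Arr E"
    and "f \<in> Arr C \<Longrightarrow> Dom E (amap F f) = omap F (Dom C f)"
    and "f \<in> Arr C \<Longrightarrow> Cod E (amap F f) = omap F (Cod C f)"
    and "x \<in> Obj C \<Longrightarrow> amap F (Idn C x) = Idn E (omap F x)"
    and "\<lbrakk>f \<in> Arr C; g \<in> Arr C; Dom C g = Cod C f\<rbrakk> \<Longrightarrow> amap F (g \<cdot>\<^bsub>C\<^esub> f) = amap F g \<cdot>\<^bsub>E\<^esub> amap F f"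
  using omap_Obj amap_hom[of f] amap_Idn amap_Comp[of f] by (auto simp: in_hom_def)

context double_category
begin

sublocale V: category "D0 D"
  using Src_functor by (simp add: is_functor_def)

sublocale H: category "D1 D"
  using Src_functor by (simp add: is_functor_def)

sublocale S: is_functor "D1 D" "D0 D" "Src D"
  by (rule Src_functor)

sublocale T: is_functor "D1 D" "D0 D" "Tgt D"
  by (rule Tgt_functor)

sublocale U: is_functor "D0 D" "D1 D" "HUnit D"
  by (rule HUnit_functor)

declare src1_hunit [simp] tgt1_hunit [simp] src2_hunit [simp] tgt2_hunit [simp]
  src1_hcomp [simp] tgt1_hcomp [simp] src2_hcomp [simp] tgt2_hcomp [simp]

lemma hcomp1_Obj [simp]:
  "\<lbrakk>M \<in> Obj (D1 D); N \<in> Obj (D1 D); src1 D M = tgt1 D N\<rbrakk> \<Longrightarrow> M \<odot> N \<in> Obj (D1 D)"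
  using is_functor.omap_Obj[OF HComp_functor, of "(M, N)"]
  by (simp add: pullback_cat_def)

lemma hcomp2_simps [simp]:
  assumes "\<alpha> \<in> Arr (D1 D)" "\<beta> \<in> Arr (D1 D)" "src2 D \<alpha> = tgt2 D \<beta>"
  shows "\<alpha> \<circledast> \<beta> \<in> Arr (D1 D)"
    and "Dom (D1 D) (\<alpha> \<circledast> \<beta>) = Dom (D1 D) \<alpha> \<odot> Dom (D1 D) \<beta>"
    and "Cod (D1 D) (\<alpha> \<circledast> \<beta>) = Cod (D1 D) \<alpha> \<odot> Cod (D1 D) \<beta>"
  using is_functor.functor_simps(2,3,4)[OF HComp_functor, of "(\<alpha>, \<beta>)"] assms
  by (auto simp add: pullback_cat_def prod_cat_def)

lemma hcomp2_hid [simp]: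
  "\<lbrakk>M \<in> Obj (D1 D); N \<in> Obj (D1 D); src1 D M = tgt1 D N\<rbrakk> \<Longrightarrow> hid D M \<circledast> hid D N = hid D (M \<odot> N)"
  using is_functor.amap_Idn[OF HComp_functor, of "(M, N)"]
  by (simp add: pullback_cat_def prod_cat_def)

lemma interchange:
  assumes "\<alpha> \<in> Arr (D1 D)" "\<alpha>' \<in> Arr (D1 D)" "Dom (D1 D) \<alpha>' = Cod (D1 D) \<alpha>"
    and "\<beta> \<in> Arr (D1 D)" "\<beta>' \<in> Arr (D1 D)" "Dom (D1 D) \<beta>' = Cod (D1 D) \<beta>"
    and "src2 D \<alpha> = tgt2 D \<beta>" "src2 D \<alpha>' = tgt2 D \<beta>'"
  shows "(\<alpha>' \<circledast> \<beta>') \<bullet> (\<alpha> \<circledast> \<beta>) = (\<alpha>' \<bullet> \<alpha>) \<circledast> (\<beta>' \<bullet> \<beta>)"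
  using is_functor.amap_Comp[OF HComp_functor, of "(\<alpha>, \<beta>)" _ _ "(\<alpha>', \<beta>')"] assms
  by (simp add: pullback_cat_def prod_cat_def in_hom_def)

text \<open>The form of the interchange law that applies inside a composite associated to the right.\<close>

lemma interchange_rest:
  assumes "\<alpha> \<in> Arr (D1 D)" "\<alpha>' \<in> Arr (D1 D)" "Dom (D1 D) \<alpha>' = Cod (D1 D) \<alpha>"
    and "\<beta> \<in> Arr (D1 D)" "\<beta>' \<in> Arr (D1 D)" "Dom (D1 D) \<beta>' = Cod (D1 D) \<beta>"
    and "src2 D \<alpha> = tgt2 D \<beta>" "src2 D \<alpha>' = tgt2 D \<beta>'"
    and "\<gamma> \<in> Arr (D1 D)" "Cod (D1 D) \<gamma> = Dom (D1 D) \<alpha> \<odot> Dom (D1 D) \<beta>"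
  shows "(\<alpha>' \<circledast> \<beta>') \<bullet> (\<alpha> \<circledast> \<beta>) \<bullet> \<gamma> = ((\<alpha>' \<bullet> \<alpha>) \<circledast> (\<beta>' \<bullet> \<beta>)) \<bullet> \<gamma>"
  using assms by (simp add: H.assoc_Arr[symmetric] interchange)

lemma Assoc_simps [simp]:
  assumes "M \<in> Obj (D1 D)" "N \<in> Obj (D1 D)" "P \<in> Obj (D1 D)" "src1 D M = tgt1 D N" "src1 D N = tgt1 D P"
  shows "Assoc D M N P \<in> Arr (D1 D)" "Dom (D1 D) (Assoc D M N P) = (M \<odot> N) \<odot> P"
    and "Cod (D1 D) (Assoc D M N P) = M \<odot> (N \<odot> P)"
    and "src2 D (Assoc D M N P) = Idn (D0 D) (src1 D P)"
    and "tgt2 D (Assoc D M N P) = Idn (D0 D) (tgt1 D M)"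
  using Assoc_hom[OF assms] src2_Assoc[OF assms] tgt2_Assoc[OF assms] by (auto simp: in_hom_def)

lemma LUnit_simps [simp]:
  assumes "M \<in> Obj (D1 D)"
  shows "LUnit D M \<in> Arr (D1 D)" "Dom (D1 D) (LUnit D M) = hunit1 D (tgt1 D M) \<odot> M"
    and "Cod (D1 D) (LUnit D M) = M"
    and "src2 D (LUnit D M) = Idn (D0 D) (src1 D M)"
    and "tgt2 D (LUnit D M) = Idn (D0 D) (tgt1 D M)"
  using LUnit_hom[OF assms] src2_LUnit[OF assms] tgt2_LUnit[OF assms] by (auto simp: in_hom_def)

lemma RUnit_simps [simp]:
  assumes "M \<in> Obj (D1 D)"
  shows "RUnit D M \<in> Arr (D1 D)" "Dom (D1 D) (RUnit D M) = M \<odot> hunit1 D (src1 D M)"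
    and "Cod (D1 D) (RUnit D M) = M"
    and "src2 D (RUnit D M) = Idn (D0 D) (src1 D M)"
    and "tgt2 D (RUnit D M) = Idn (D0 D) (tgt1 D M)"
  using RUnit_hom[OF assms] src2_RUnit[OF assms] tgt2_RUnit[OF assms] by (auto simp: in_hom_def)

text \<open>Naturality of the constraints as rewrite rules that move a constraint to the right end of a
  composite. The targets are variables so that the rules match before the targets are computed.\<close>

lemma Assoc_slide:
  assumes "\<alpha> \<in> Arr (D1 D)" "\<beta> \<in> Arr (D1 D)" "\<gamma> \<in> Arr (D1 D)"
    and "src2 D \<alpha> = tgt2 D \<beta>" "src2 D \<beta> = tgt2 D \<gamma>"
    and "M' = Cod (D1 D) \<alpha>" "N' = Cod (D1 D) \<beta>" "P' = Cod (D1 D) \<gamma>"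
  shows "Assoc D M' N' P' \<bullet> ((\<alpha> \<circledast> \<beta>) \<circledast> \<gamma>) =
    (\<alpha> \<circledast> (\<beta> \<circledast> \<gamma>)) \<bullet> Assoc D (Dom (D1 D) \<alpha>) (Dom (D1 D) \<beta>) (Dom (D1 D) \<gamma>)"
  using Assoc_natural assms by (auto simp: in_hom_def)

lemma LUnit_slide:
  assumes "\<alpha> \<in> Arr (D1 D)" "M' = Cod (D1 D) \<alpha>" "f = tgt2 D \<alpha>"
  shows "LUnit D M' \<bullet> (hunit2 D f \<circledast> \<alpha>) = \<alpha> \<bullet> LUnit D (Dom (D1 D) \<alpha>)"
  using LUnit_natural assms by (auto simp: in_hom_def)

lemma RUnit_slide:
  assumes "\<alpha> \<in> Arr (D1 D)" "M' = Cod (D1 D) \<alpha>" "f = src2 D \<alpha>"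
  shows "RUnit D M' \<bullet> (\<alpha> \<circledast> hunit2 D f) = \<alpha> \<bullet> RUnit D (Dom (D1 D) \<alpha>)"
  using RUnit_natural assms by (auto simp: in_hom_def)

lemma globular_iso_inverse:
  assumes "is_iso (D1 D) \<alpha>" "src2 D \<alpha> = Idn (D0 D) X" "tgt2 D \<alpha> = Idn (D0 D) Y"
    "X \<in> Obj (D0 D)" "Y \<in> Obj (D0 D)"
  obtains \<beta> where "\<beta> \<in> Arr (D1 D)" "Dom (D1 D) \<beta> = Cod (D1 D) \<alpha>" "Cod (D1 D) \<beta> = Dom (D1 D) \<alpha>"
    "src2 D \<beta> = Idn (D0 D) X" "tgt2 D \<beta> = Idn (D0 D) Y"
    "\<beta> \<bullet> \<alpha> = hid D (Dom (D1 D) \<alpha>)" "\<alpha> \<bullet> \<beta> = hid D (Cod (D1 D) \<alpha>)"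
proof -
  obtain \<beta> where b: "\<beta> \<in> Arr (D1 D)" "Dom (D1 D) \<beta> = Cod (D1 D) \<alpha>" "Cod (D1 D) \<beta> = Dom (D1 D) \<alpha>"
    "\<beta> \<bullet> \<alpha> = hid D (Dom (D1 D) \<alpha>)" "\<alpha> \<bullet> \<beta> = hid D (Cod (D1 D) \<alpha>)" and a: "\<alpha> \<in> Arr (D1 D)"
    using assms(1) by (auto simp: is_iso_def in_hom_def)
  have d: "src1 D (Dom (D1 D) \<alpha>) = X" "src1 D (Cod (D1 D) \<alpha>) = X"
      "tgt1 D (Dom (D1 D) \<alpha>) = Y" "tgt1 D (Cod (D1 D) \<alpha>) = Y"
    using a assms S.functor_simps(3,4)[of \<alpha>] T.functor_simps(3,4)[of \<alpha>] by auto
  have "src2 D (\<beta> \<bullet> \<alpha>) = Idn (D0 D) X" "tgt2 D (\<beta> \<bullet> \<alpha>) = Idn (D0 D) Y"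
    unfolding b(4) using a d by auto
  hence "src2 D \<beta> = Idn (D0 D) X" "tgt2 D \<beta> = Idn (D0 D) Y"
    using a b(1-3) assms d by auto
  thus thesis using that b by blast
qed

section \<open>Coherence of the unit constraints\<close>

text \<open>These are Kelly's arguments for monoidal categories: the coherences of the units beyond
  the triangle identity follow from it, because tensoring with a unit is naturally isomorphic to the
  identity and hence faithful on globular 2-cells.\<close>

lemma hunit_lwhisker_faithful:
  assumes "\<alpha> \<in> Arr (D1 D)" "\<beta> \<in> Arr (D1 D)" "Dom (D1 D) \<alpha> = Dom (D1 D) \<beta>" "Cod (D1 D) \<alpha> = Cod (D1 D) \<beta>"
    and "tgt2 D \<alpha> = Idn (D0 D) Y" "tgt2 D \<beta> = Idn (D0 D) Y" "Y \<in> Obj (D0 D)"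
    and eq: "hid D (hunit1 D Y) \<circledast> \<alpha> = hid D (hunit1 D Y) \<circledast> \<beta>"
  shows "\<alpha> = \<beta>"
proof (rule H.iso_cancel_right[OF LUnit_iso[of "Dom (D1 D) \<beta>"]])
  show "\<alpha> \<bullet> LUnit D (Dom (D1 D) \<beta>) = \<beta> \<bullet> LUnit D (Dom (D1 D) \<beta>)"
    using LUnit_slide[of \<alpha> "Cod (D1 D) \<beta>" "Idn (D0 D) Y"] LUnit_slide[of \<beta> "Cod (D1 D) \<beta>" "Idn (D0 D) Y"] assms
    by simp
qed (use assms in auto)

lemma hunit_rwhisker_faithful:
  assumes "\<alpha> \<in> Arr (D1 D)" "\<beta> \<in> Arr (D1 D)" "Dom (D1 D) \<alpha> = Dom (D1 D) \<beta>" "Cod (D1 D) \<alpha> = Cod (D1 D) \<beta>"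
    and "src2 D \<alpha> = Idn (D0 D) X" "src2 D \<beta> = Idn (D0 D) X" "X \<in> Obj (D0 D)"
    and eq: "\<alpha> \<circledast> hid D (hunit1 D X) = \<beta> \<circledast> hid D (hunit1 D X)"
  shows "\<alpha> = \<beta>"
proof (rule H.iso_cancel_right[OF RUnit_iso[of "Dom (D1 D) \<beta>"]])
  show "\<alpha> \<bullet> RUnit D (Dom (D1 D) \<beta>) = \<beta> \<bullet> RUnit D (Dom (D1 D) \<beta>)"
    using RUnit_slide[of \<alpha> "Cod (D1 D) \<beta>" "Idn (D0 D) X"] RUnit_slide[of \<beta> "Cod (D1 D) \<beta>" "Idn (D0 D) X"] assms
    by simp
qed (use assms in auto)

lemma iso_rwhisker:
  assumes "is_iso (D1 D) \<alpha>" "src2 D \<alpha> = Idn (D0 D) X" "tgt2 D \<alpha> = Idn (D0 D) Y"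
    "X \<in> Obj (D0 D)" "Y \<in> Obj (D0 D)" "N \<in> Obj (D1 D)" "tgt1 D N = X"
  shows "is_iso (D1 D) (\<alpha> \<circledast> hid D N)"
proof -
  obtain \<beta> where b: "\<beta> \<in> Arr (D1 D)" "Dom (D1 D) \<beta> = Cod (D1 D) \<alpha>" "Cod (D1 D) \<beta> = Dom (D1 D) \<alpha>"
    "src2 D \<beta> = Idn (D0 D) X" "tgt2 D \<beta> = Idn (D0 D) Y"
    "\<beta> \<bullet> \<alpha> = hid D (Dom (D1 D) \<alpha>)" "\<alpha> \<bullet> \<beta> = hid D (Cod (D1 D) \<alpha>)"
    using globular_iso_inverse[OF assms(1-5)] by blast
  have a: "\<alpha> \<in> Arr (D1 D)" using assms(1) by (simp add: is_iso_def)
  have d: "src1 D (Dom (D1 D) \<alpha>) = X" "src1 D (Cod (D1 D) \<alpha>) = X"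
    using a assms S.functor_simps(3,4)[of \<alpha>] by auto
  show ?thesis unfolding is_iso_def in_hom_def
    by (intro conjI exI[of _ "\<beta> \<circledast> hid D N"]) (use a b d assms in \<open>auto simp: interchange\<close>)
qed

text \<open>After tensoring with the unit on the left, the two sides agree when precomposed with the
  isomorphism given by two sides of the pentagon for \<open>I, I, M, N\<close>; the triangle identity turns each
  left unit constraint into \<open>RUnit I\<close>.\<close>

lemma LUnit_hcomp:
  assumes [simp]: "M \<in> Obj (D1 D)" "N \<in> Obj (D1 D)" "src1 D M = tgt1 D N"
  shows "LUnit D (M \<odot> N) \<bullet> Assoc D (hunit1 D (tgt1 D M)) M N = LUnit D M \<circledast> hid D N"
proof -
  define Y where "Y = tgt1 D M"
  define I where "I = hunit1 D Y"
  have [simp]: "Y \<in> Obj (D0 D)" "tgt1 D M = Y" "I \<in> Obj (D1 D)" "src1 D I = Y" "tgt1 D I = Y" "hunit1 D Y = I"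
    by (simp_all add: I_def Y_def)
  let ?k = "Assoc D I (I \<odot> M) N \<bullet> (Assoc D I I M \<circledast> hid D N)"
  have tri: "RUnit D I \<circledast> hid D K = (hid D I \<circledast> LUnit D K) \<bullet> Assoc D I I K"
    if "K \<in> Obj (D1 D)" "tgt1 D K = Y" for K
    using triangle[of I K] that by simp
  have "hid D I \<circledast> (LUnit D (M \<odot> N) \<bullet> Assoc D I M N) = hid D I \<circledast> (LUnit D M \<circledast> hid D N)"
  proof (rule H.iso_cancel_right[of "Assoc D I (I \<odot> M) N"])
    show "(hid D I \<circledast> (LUnit D (M \<odot> N) \<bullet> Assoc D I M N)) \<bullet> Assoc D I (I \<odot> M) N =
      (hid D I \<circledast> (LUnit D M \<circledast> hid D N)) \<bullet> Assoc D I (I \<odot> M) N"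
    proof (rule H.iso_cancel_right[of "Assoc D I I M \<circledast> hid D N"])
      have "((hid D I \<circledast> (LUnit D (M \<odot> N) \<bullet> Assoc D I M N)) \<bullet> Assoc D I (I \<odot> M) N) \<bullet> (Assoc D I I M \<circledast> hid D N)
        = (hid D I \<circledast> LUnit D (M \<odot> N)) \<bullet> (hid D I \<circledast> Assoc D I M N) \<bullet> ?k"
        by (simp add: H.assoc_Arr interchange_rest)
      also have "\<dots> = ((hid D I \<circledast> LUnit D (M \<odot> N)) \<bullet> Assoc D I I (M \<odot> N)) \<bullet> Assoc D (I \<odot> I) M N"
        using pentagon[of I I M N] by (simp add: H.assoc_Arr)
      also have "\<dots> = (RUnit D I \<circledast> hid D (M \<odot> N)) \<bullet> Assoc D (I \<odot> I) M N"
        using tri[of "M \<odot> N"] by simp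
      also have "\<dots> = Assoc D I M N \<bullet> ((RUnit D I \<circledast> hid D M) \<circledast> hid D N)"
        using Assoc_slide[of "RUnit D I" "hid D M" "hid D N" I M N] by simp
      also have "\<dots> = (Assoc D I M N \<bullet> ((hid D I \<circledast> LUnit D M) \<circledast> hid D N)) \<bullet> (Assoc D I I M \<circledast> hid D N)"
        using tri[of M] by (simp add: H.assoc_Arr interchange)
      also have "\<dots> = ((hid D I \<circledast> (LUnit D M \<circledast> hid D N)) \<bullet> Assoc D I (I \<odot> M) N) \<bullet> (Assoc D I I M \<circledast> hid D N)"
        by (simp add: Assoc_slide)
      finally show "((hid D I \<circledast> (LUnit D (M \<odot> N) \<bullet> Assoc D I M N)) \<bullet> Assoc D I (I \<odot> M) N) \<bullet> (Assoc D I I M \<circledast> hid D N)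
        = ((hid D I \<circledast> (LUnit D M \<circledast> hid D N)) \<bullet> Assoc D I (I \<odot> M) N) \<bullet> (Assoc D I I M \<circledast> hid D N)" .
    qed (auto intro!: iso_rwhisker[of _ _ Y] Assoc_iso)
  qed (auto intro!: Assoc_iso)
  then show ?thesis
    by - (rule hunit_lwhisker_faithful[where Y = Y], simp_all)
qed

text \<open>The mirror image: tensor with the unit on the right, postcompose with the associator, and use
  the pentagon for \<open>M, N, I, I\<close>.\<close>

lemma RUnit_hcomp:
  assumes [simp]: "M \<in> Obj (D1 D)" "N \<in> Obj (D1 D)" "src1 D M = tgt1 D N"
  shows "RUnit D (M \<odot> N) = (hid D M \<circledast> RUnit D N) \<bullet> Assoc D M N (hunit1 D (src1 D N))"
proof -
  define X where "X = src1 D N"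
  define I where "I = hunit1 D X"
  have [simp]: "X \<in> Obj (D0 D)" "src1 D N = X" "I \<in> Obj (D1 D)" "src1 D I = X" "tgt1 D I = X" "hunit1 D X = I"
    by (simp_all add: I_def X_def)
  have tri: "RUnit D K \<circledast> hid D I = (hid D K \<circledast> LUnit D I) \<bullet> Assoc D K I I"
    if "K \<in> Obj (D1 D)" "src1 D K = X" for K
    using triangle[of K I] that by simp
  have "RUnit D (M \<odot> N) \<circledast> hid D I = ((hid D M \<circledast> RUnit D N) \<bullet> Assoc D M N I) \<circledast> hid D I"
  proof (rule H.iso_cancel_left[of "Assoc D M N I"])
    have "Assoc D M N I \<bullet> (RUnit D (M \<odot> N) \<circledast> hid D I)
        = (Assoc D M N I \<bullet> ((hid D M \<circledast> hid D N) \<circledast> LUnit D I)) \<bullet> Assoc D (M \<odot> N) I I"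
      using tri[of "M \<odot> N"] by (simp add: H.assoc_Arr)
    also have "\<dots> = (hid D M \<circledast> (hid D N \<circledast> LUnit D I)) \<bullet> Assoc D M N (I \<odot> I) \<bullet> Assoc D (M \<odot> N) I I"
      by (subst Assoc_slide) (simp_all add: H.assoc_Arr)
    also have "\<dots> = (hid D M \<circledast> (hid D N \<circledast> LUnit D I)) \<bullet> (hid D M \<circledast> Assoc D N I I) \<bullet>
        Assoc D M (N \<odot> I) I \<bullet> (Assoc D M N I \<circledast> hid D I)"
      using pentagon[of M N I I] by simp
    also have "\<dots> = ((hid D M \<circledast> (RUnit D N \<circledast> hid D I)) \<bullet> Assoc D M (N \<odot> I) I) \<bullet> (Assoc D M N I \<circledast> hid D I)"
      using tri[of N] by (simp add: interchange_rest H.assoc_Arr)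
    also have "\<dots> = (Assoc D M N I \<bullet> ((hid D M \<circledast> RUnit D N) \<circledast> hid D I)) \<bullet> (Assoc D M N I \<circledast> hid D I)"
      by (simp add: Assoc_slide)
    also have "\<dots> = Assoc D M N I \<bullet> (((hid D M \<circledast> RUnit D N) \<bullet> Assoc D M N I) \<circledast> hid D I)"
      by (simp add: interchange H.assoc_Arr)
    finally show "Assoc D M N I \<bullet> (RUnit D (M \<odot> N) \<circledast> hid D I) =
      Assoc D M N I \<bullet> (((hid D M \<circledast> RUnit D N) \<bullet> Assoc D M N I) \<circledast> hid D I)" .
  qed (auto intro!: Assoc_iso)
  then show ?thesis
    by - (rule hunit_rwhisker_faithful[where X = X], simp_all)
qed

text \<open>Naturality of the left unit constraint at itself gives \<open>LUnit (I \<odot> I) = id \<odot> LUnit I\<close>; then the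
  triangle identity and \<open>LUnit_hcomp\<close> compute the same composite as \<open>RUnit I \<odot> id\<close> and as
  \<open>LUnit I \<odot> id\<close>.\<close>

lemma LUnit_hunit:
  assumes [simp]: "X \<in> Obj (D0 D)"
  shows "LUnit D (hunit1 D X) = RUnit D (hunit1 D X)"
proof -
  let ?I = "hunit1 D X"
  have "LUnit D (?I \<odot> ?I) = hid D ?I \<circledast> LUnit D ?I"
    by (rule H.iso_cancel_left[OF LUnit_iso[of ?I]])
      (use LUnit_slide[of "LUnit D ?I" ?I "Idn (D0 D) X"] in auto)
  hence "LUnit D ?I \<circledast> hid D ?I = RUnit D ?I \<circledast> hid D ?I"
    using LUnit_hcomp[of ?I ?I] triangle[of ?I ?I] by simp
  thus ?thesis
    by - (rule hunit_rwhisker_faithful[where X = X], simp_all)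
qed

section \<open>Coproducts of horizontal 1-cells\<close>

definition square :: "'c \<Rightarrow> 'h \<Rightarrow> 'h \<Rightarrow> 'v \<Rightarrow> 'v \<Rightarrow> bool" where
  "square \<alpha> M N v w \<longleftrightarrow> in_hom (D1 D) \<alpha> M N \<and> src2 D \<alpha> = v \<and> tgt2 D \<alpha> = w"

lemma square_iff:
  "square \<alpha> M N v w \<longleftrightarrow> \<alpha> \<in> Arr (D1 D) \<and> Dom (D1 D) \<alpha> = M \<and> Cod (D1 D) \<alpha> = N \<and>
    src2 D \<alpha> = v \<and> tgt2 D \<alpha> = w"
  by (auto simp: square_def in_hom_def)

lemma squareD:
  assumes "square \<alpha> M N v w"
  shows "\<alpha> \<in> Arr (D1 D)" "Dom (D1 D) \<alpha> = M" "Cod (D1 D) \<alpha> = N" "src2 D \<alpha> = v" "tgt2 D \<alpha> = w"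
    and "M \<in> Obj (D1 D)" "N \<in> Obj (D1 D)" "v \<in> Arr (D0 D)" "w \<in> Arr (D0 D)"
    and "src1 D M = Dom (D0 D) v" "src1 D N = Cod (D0 D) v"
    and "tgt1 D M = Dom (D0 D) w" "tgt1 D N = Cod (D0 D) w"
  using assms S.functor_simps(2-4)[of \<alpha>] T.functor_simps(2-4)[of \<alpha>] by (auto simp: square_iff)

lemma globular_squareD:
  assumes "square \<alpha> M N (Idn (D0 D) X) (Idn (D0 D) Y)" "X \<in> Obj (D0 D)" "Y \<in> Obj (D0 D)"
  shows "\<alpha> \<in> Arr (D1 D)" "Dom (D1 D) \<alpha> = M" "Cod (D1 D) \<alpha> = N"
    and "src2 D \<alpha> = Idn (D0 D) X" "tgt2 D \<alpha> = Idn (D0 D) Y"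
    and "M \<in> Obj (D1 D)" "N \<in> Obj (D1 D)"
    and "src1 D M = X" "src1 D N = X" "tgt1 D M = Y" "tgt1 D N = Y"
  using squareD[OF assms(1)] assms(2,3) by auto

lemma globular_iff:
  assumes "in_hom (D1 D) \<alpha> M N"
  shows "globular D \<alpha> \<longleftrightarrow> src2 D \<alpha> = Idn (D0 D) (src1 D M) \<and> tgt2 D \<alpha> = Idn (D0 D) (tgt1 D M)"
proof -
  have a: "\<alpha> \<in> Arr (D1 D)" "Dom (D1 D) \<alpha> = M" using assms by (auto simp: in_hom_def)
  have M: "M \<in> Obj (D1 D)" using a by auto
  have "src1 D M = Dom (D0 D) (src2 D \<alpha>)" "tgt1 D M = Dom (D0 D) (tgt2 D \<alpha>)"
    using a by auto
  hence "globular D \<alpha> \<Longrightarrow> src2 D \<alpha> = Idn (D0 D) (src1 D M) \<and> tgt2 D \<alpha> = Idn (D0 D) (tgt1 D M)"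
    unfolding globular_def by (metis V.Idn_simps(2))
  thus ?thesis using a M by (auto simp: globular_def)
qed

lemma local_cat_simps [simp]:
  assumes "X \<in> Obj (D0 D)" "Y \<in> Obj (D0 D)"
  shows "M \<in> Obj (local_cat D X Y) \<longleftrightarrow> M \<in> Obj (D1 D) \<and> src1 D M = X \<and> tgt1 D M = Y"
    and "\<alpha> \<in> Arr (local_cat D X Y) \<longleftrightarrow>
      \<alpha> \<in> Arr (D1 D) \<and> src2 D \<alpha> = Idn (D0 D) X \<and> tgt2 D \<alpha> = Idn (D0 D) Y"
    and "in_hom (local_cat D X Y) \<alpha> M N \<longleftrightarrow> square \<alpha> M N (Idn (D0 D) X) (Idn (D0 D) Y)"
    and "Comp (local_cat D X Y) = Comp (D1 D)"
    and "Idn (local_cat D X Y) = Idn (D1 D)"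
    and "Dom (local_cat D X Y) = Dom (D1 D)"
    and "Cod (local_cat D X Y) = Cod (D1 D)"
  using assms by (auto simp: local_cat_def globular_def square_iff in_hom_def)

lemma category_local_cat:
  assumes [simp]: "X \<in> Obj (D0 D)" "Y \<in> Obj (D0 D)"
  shows "category (local_cat D X Y)"
proof
  fix f assume "f \<in> Arr (local_cat D X Y)"
  hence "square f (Dom (D1 D) f) (Cod (D1 D) f) (Idn (D0 D) X) (Idn (D0 D) Y)"
    by (simp add: square_iff)
  from globular_squareD[OF this]
  show "Dom (local_cat D X Y) f \<in> Obj (local_cat D X Y)" "Cod (local_cat D X Y) f \<in> Obj (local_cat D X Y)"
    by simp_all
qed (auto simp: square_iff H.assoc_Arr)

lemma cartesian_lift:
  assumes fib: "fibrant D" and Z: "Z \<in> Obj (D1 D)"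
    and v: "v \<in> Arr (D0 D)" "Cod (D0 D) v = src1 D Z" and w: "w \<in> Arr (D0 D)" "Cod (D0 D) w = tgt1 D Z"
  obtains Z' \<phi> where "square \<phi> Z' Z v w"
    and "\<And>Q \<psi>. square \<psi> Q Z v w \<Longrightarrow>
      \<exists>!\<chi>. square \<chi> Q Z' (Idn (D0 D) (Dom (D0 D) v)) (Idn (D0 D) (Dom (D0 D) w)) \<and> \<phi> \<bullet> \<chi> = \<psi>"
proof -
  let ?B = "prod_cat (D0 D) (D0 D)" and ?P = "pair_fctr (Src D) (Tgt D)"
  obtain \<phi> where c: "cartesian (D1 D) ?B ?P \<phi>" "Cod (D1 D) \<phi> = Z" "amap ?P \<phi> = (v, w)"
  proof -
    have vw: "(v, w) \<in> Arr ?B" "Cod ?B (v, w) = omap ?P Z"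
      using v w by (simp_all add: prod_cat_def pair_fctr_def)
    show thesis
      using fib[unfolded fibrant_def fibration_def, THEN conjunct2, rule_format, OF Z vw] that by metis
  qed
  have phi: "square \<phi> (Dom (D1 D) \<phi>) Z v w"
    using c by (simp add: cartesian_def square_iff pair_fctr_def)
  note p = squareD[OF phi]
  show thesis
  proof (rule that[OF phi])
    fix Q \<psi> assume psi: "square \<psi> Q Z v w"
    let ?g = "(Idn (D0 D) (Dom (D0 D) v), Idn (D0 D) (Dom (D0 D) w))"
    have "\<exists>!\<chi>. in_hom (D1 D) \<chi> (Dom (D1 D) \<psi>) (Dom (D1 D) \<phi>) \<and> amap ?P \<chi> = ?g \<and> \<phi> \<bullet> \<chi> = \<psi>"
    proof -
      have "Cod ?B ?g = omap ?P (Dom (D1 D) \<phi>)" "?g \<in> Arr ?B"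
        "amap ?P \<psi> = amap ?P \<phi> \<cdot>\<^bsub>?B\<^esub> ?g" "Cod (D1 D) \<psi> = Cod (D1 D) \<phi>" "\<psi> \<in> Arr (D1 D)"
        using p squareD[OF psi] by (simp_all add: prod_cat_def pair_fctr_def)
      with c(1)[unfolded cartesian_def, THEN conjunct2, rule_format, of \<psi> ?g] show ?thesis by simp
    qed
    thus "\<exists>!\<chi>. square \<chi> Q (Dom (D1 D) \<phi>) (Idn (D0 D) (Dom (D0 D) v)) (Idn (D0 D) (Dom (D0 D) w)) \<and> \<phi> \<bullet> \<chi> = \<psi>"
      using squareD(2)[OF psi] by (simp add: square_def pair_fctr_def conj_assoc)
  qed
qed

text \<open>A coproduct in a local category whose universal property extends to cocones of 2-cells over
  arbitrary vertical 1-cells.\<close>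

definition square_coproduct :: "(nat \<Rightarrow> 'h) \<Rightarrow> 'h \<Rightarrow> (nat \<Rightarrow> 'c) \<Rightarrow> 'o \<Rightarrow> 'o \<Rightarrow> bool" where
  "square_coproduct P T \<iota> X Y \<longleftrightarrow>
    (\<forall>n. square (\<iota> n) (P n) T (Idn (D0 D) X) (Idn (D0 D) Y)) \<and>
    (\<forall>Z \<kappa> v w. (\<forall>n. square (\<kappa> n) (P n) Z v w) \<longrightarrow>
      (\<exists>!h. square h T Z v w \<and> (\<forall>n. h \<bullet> \<iota> n = \<kappa> n)))"

lemma square_coproduct_eqI:
  assumes c: "square_coproduct P T \<iota> X Y" and XY: "X \<in> Obj (D0 D)" "Y \<in> Obj (D0 D)"
    and h: "square h T Z v w" and h': "square h' T Z v w"
    and eq: "\<And>n. h \<bullet> \<iota> n = h' \<bullet> \<iota> n"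
  shows "h = h'"
proof -
  have "square (h \<bullet> \<iota> n) (P n) Z v w" for n
  proof -
    have "square (\<iota> n) (P n) T (Idn (D0 D) X) (Idn (D0 D) Y)" using c by (simp add: square_coproduct_def)
    note globular_squareD[OF this XY, simp] 
    have "Dom (D0 D) v = X" "Dom (D0 D) w = Y" using squareD(10,12)[OF h] by auto
    thus ?thesis using squareD[OF h] unfolding square_iff by auto
  qed
  hence "\<exists>!k. square k T Z v w \<and> (\<forall>n. k \<bullet> \<iota> n = h \<bullet> \<iota> n)"
    using c[unfolded square_coproduct_def, THEN conjunct2, rule_format, of "\<lambda>n. h \<bullet> \<iota> n"] by simp
  thus ?thesis using h h' eq by metis
qed

text \<open>Fibrancy enters here. A cocone over \<open>(v, w)\<close> into \<open>Z\<close> factors componentwise through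
  a cartesian lift \<open>\<phi> : Z' \<Rightarrow> Z\<close> of \<open>(v, w)\<close>, giving a globular cocone into \<open>Z'\<close>. The local
  coproduct provides a unique factorization of that cocone, and uniqueness of factorizations through
  \<open>\<phi>\<close> transfers it back.\<close>

lemma local_coproduct_is_square_coproduct:
  assumes fib: "fibrant D" and XY: "X \<in> Obj (D0 D)" "Y \<in> Obj (D0 D)"
    and col: "is_colimit (discrete_cat UNIV) (local_cat D X Y) J T \<iota>"
  shows "square_coproduct (omap J) T \<iota> X Y"
proof -
  interpret J: is_functor "discrete_cat UNIV" "local_cat D X Y" J
    using col by (simp add: is_colimit_def)
  have J_id: "amap J n = hid D (omap J n)" for n
    using J.functor_simps(5)[of n] XY by (simp add: discrete_cat_def)
  have J_Obj: "omap J n \<in> Obj (D1 D)" "src1 D (omap J n) = X" "tgt1 D (omap J n) = Y" for n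
    using J.functor_simps(1)[of n] XY by (simp_all add: discrete_cat_def)
  have cocone_iff: "cocone (discrete_cat UNIV) (local_cat D X Y) J d \<kappa> \<longleftrightarrow>
      d \<in> Obj (D1 D) \<and> src1 D d = X \<and> tgt1 D d = Y \<and>
      (\<forall>n. square (\<kappa> n) (omap J n) d (Idn (D0 D) X) (Idn (D0 D) Y))" for d \<kappa>
    using XY by (auto simp: cocone_def discrete_cat_def J_id square_iff)
  have iota: "square (\<iota> n) (omap J n) T (Idn (D0 D) X) (Idn (D0 D) Y)" for n
    using col by (simp add: is_colimit_def cocone_iff)
  note iotaD = globular_squareD[OF iota XY]
  have local_ex: "\<exists>!h. square h T d (Idn (D0 D) X) (Idn (D0 D) Y) \<and> (\<forall>n. h \<bullet> \<iota> n = \<kappa> n)"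
    if "\<And>n. square (\<kappa> n) (omap J n) d (Idn (D0 D) X) (Idn (D0 D) Y)" for d \<kappa>
  proof -
    have "cocone (discrete_cat UNIV) (local_cat D X Y) J d \<kappa>"
      unfolding cocone_iff using globular_squareD[OF that[of 0] XY] that by simp
    hence "\<exists>!h. in_hom (local_cat D X Y) h T d \<and>
        (\<forall>i\<in>Obj (discrete_cat UNIV). h \<cdot>\<^bsub>local_cat D X Y\<^esub> \<iota> i = \<kappa> i)"
      using col by (simp add: is_colimit_def)
    thus ?thesis using XY by (simp add: discrete_cat_def)
  qed
  have "\<exists>!h. square h T Z v w \<and> (\<forall>n. h \<bullet> \<iota> n = \<kappa> n)"
    if k: "\<And>n. square (\<kappa> n) (omap J n) Z v w" for Z \<kappa> v w
  proof -
    have dom: "Dom (D0 D) v = X" "Dom (D0 D) w = Y"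
      using squareD(10,12)[OF k[of 0]] J_Obj[of 0] by auto
    obtain Z' \<phi> where phi: "square \<phi> Z' Z v w"
      and fac: "\<And>Q \<psi>. square \<psi> Q Z v w \<Longrightarrow>
        \<exists>!\<chi>. square \<chi> Q Z' (Idn (D0 D) X) (Idn (D0 D) Y) \<and> \<phi> \<bullet> \<chi> = \<psi>"
      using cartesian_lift[OF fib] squareD[OF k[of 0]] dom by metis
    obtain \<kappa>' where k': "\<And>n. square (\<kappa>' n) (omap J n) Z' (Idn (D0 D) X) (Idn (D0 D) Y)"
      and kk': "\<And>n. \<phi> \<bullet> \<kappa>' n = \<kappa> n"
      using fac[OF k] by metis
    note [simp] = squareD[OF phi] iotaD dom
    show ?thesis
    proof (rule ex_ex1I)
      obtain h where h: "square h T Z' (Idn (D0 D) X) (Idn (D0 D) Y)" "\<And>n. h \<bullet> \<iota> n = \<kappa>' n"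
        using local_ex[OF k'] by metis
      note [simp] = globular_squareD[OF h(1) XY]
      have "\<forall>n. (\<phi> \<bullet> h) \<bullet> \<iota> n = \<kappa> n"
        by (simp add: H.assoc_Arr h(2) kk')
      moreover have "square (\<phi> \<bullet> h) T Z v w"
        by (simp add: square_iff)
      ultimately show "\<exists>h. square h T Z v w \<and> (\<forall>n. h \<bullet> \<iota> n = \<kappa> n)" by blast
    next
      fix h1 h2
      assume 1: "square h1 T Z v w \<and> (\<forall>n. h1 \<bullet> \<iota> n = \<kappa> n)"
        and 2: "square h2 T Z v w \<and> (\<forall>n. h2 \<bullet> \<iota> n = \<kappa> n)"
      obtain g1 where g1: "square g1 T Z' (Idn (D0 D) X) (Idn (D0 D) Y)" "\<phi> \<bullet> g1 = h1"
        using fac 1 by blast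
      obtain g2 where g2: "square g2 T Z' (Idn (D0 D) X) (Idn (D0 D) Y)" "\<phi> \<bullet> g2 = h2"
        using fac 2 by blast
      note [simp] = globular_squareD[OF g1(1) XY] globular_squareD[OF g2(1) XY]
      have comp: "g1 \<bullet> \<iota> n = \<kappa>' n \<and> g2 \<bullet> \<iota> n = \<kappa>' n" for n
      proof -
        have "\<phi> \<bullet> (g1 \<bullet> \<iota> n) = \<kappa> n" "\<phi> \<bullet> (g2 \<bullet> \<iota> n) = \<kappa> n"
          using 1 2 g1(2) g2(2) by (simp_all add: H.assoc_Arr[symmetric])
        moreover have "square (g1 \<bullet> \<iota> n) (omap J n) Z' (Idn (D0 D) X) (Idn (D0 D) Y)"
          "square (g2 \<bullet> \<iota> n) (omap J n) Z' (Idn (D0 D) X) (Idn (D0 D) Y)"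
          using XY by (simp_all add: square_iff)
        ultimately show ?thesis using fac[OF k[of n]] k'[of n] kk'[of n] by blast
      qed
      have "g1 = g2" using local_ex[OF k'] g1(1) g2(1) comp by blast
      thus "h1 = h2" using g1(2) g2(2) by simp
    qed
  qed
  thus ?thesis using iota unfolding square_coproduct_def by blast
qed

text \<open>All four universal properties are recorded for one and the same coproduct; the last one applies
  stability twice and serves to compare 2-cells out of \<open>(M \<odot> T) \<odot> N\<close>.\<close>

lemma stable_coproduct:
  assumes fib: "fibrant D" and stab: "stable_local_countable_coproducts D"
    and XY: "X \<in> Obj (D0 D)" "Y \<in> Obj (D0 D)"
    and P: "\<And>n. P n \<in> Obj (D1 D)" "\<And>n. src1 D (P n) = X" "\<And>n. tgt1 D (P n) = Y"
  obtains T \<iota> where "square_coproduct P T \<iota> X Y"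
    and "\<And>M. \<lbrakk>M \<in> Obj (D1 D); src1 D M = Y\<rbrakk> \<Longrightarrow>
      square_coproduct (\<lambda>n. M \<odot> P n) (M \<odot> T) (\<lambda>n. hid D M \<circledast> \<iota> n) X (tgt1 D M)"
    and "\<And>N. \<lbrakk>N \<in> Obj (D1 D); tgt1 D N = X\<rbrakk> \<Longrightarrow>
      square_coproduct (\<lambda>n. P n \<odot> N) (T \<odot> N) (\<lambda>n. \<iota> n \<circledast> hid D N) (src1 D N) Y"
    and "\<And>M N. \<lbrakk>M \<in> Obj (D1 D); src1 D M = Y; N \<in> Obj (D1 D); tgt1 D N = X\<rbrakk> \<Longrightarrow>
      square_coproduct (\<lambda>n. (M \<odot> P n) \<odot> N) ((M \<odot> T) \<odot> N)
        (\<lambda>n. (hid D M \<circledast> \<iota> n) \<circledast> hid D N) (src1 D N) (tgt1 D M)"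
proof -
  let ?I = "discrete_cat (UNIV :: nat set)"
  let ?J = "\<lparr>omap = P, amap = (\<lambda>n. hid D (P n))\<rparr>"
  have s: "stable_local_colimits ?I D"
    using stab by (simp add: stable_local_countable_coproducts_def)
  have "category ?I"
    by unfold_locales (auto simp: discrete_cat_def in_hom_def)
  hence "is_functor ?I (local_cat D X Y) ?J"
    using XY P category_local_cat[OF XY]
    by (auto simp: is_functor_def is_functor_axioms_def discrete_cat_def in_hom_def)
  then obtain T \<iota> where c: "is_colimit ?I (local_cat D X Y) ?J T \<iota>"
    using s XY unfolding stable_local_colimits_def has_colimits_def by meson
  have l: "is_colimit ?I (local_cat D Z (tgt1 D M)) (comp_fctr (lwhisker D M) J)
      (M \<odot> T') (\<lambda>n. hid D M \<circledast> \<iota>' n)"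
    if "M \<in> Obj (D1 D)" "is_colimit ?I (local_cat D Z (src1 D M)) J T' \<iota>'" "Z \<in> Obj (D0 D)"
    for M Z J T' \<iota>'
  proof -
    have "preserves_colimits ?I (local_cat D Z (src1 D M)) (local_cat D Z (tgt1 D M)) (lwhisker D M)"
      using s that(1,3) by (simp add: stable_local_colimits_def)
    from this[unfolded preserves_colimits_def, rule_format, OF that(2)] show ?thesis
      by (simp add: lwhisker_def)
  qed
  have r: "is_colimit ?I (local_cat D (src1 D N) Z) (comp_fctr (rwhisker D N) J)
      (T' \<odot> N) (\<lambda>n. \<iota>' n \<circledast> hid D N)"
    if "N \<in> Obj (D1 D)" "is_colimit ?I (local_cat D (tgt1 D N) Z) J T' \<iota>'" "Z \<in> Obj (D0 D)"
    for N Z J T' \<iota>'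
  proof -
    have "preserves_colimits ?I (local_cat D (tgt1 D N) Z) (local_cat D (src1 D N) Z) (rwhisker D N)"
      using s that(1,3) by (simp add: stable_local_colimits_def)
    from this[unfolded preserves_colimits_def, rule_format, OF that(2)] show ?thesis
      by (simp add: rwhisker_def)
  qed
  show thesis
  proof (rule that)
    show "square_coproduct P T \<iota> X Y"
      using local_coproduct_is_square_coproduct[OF fib XY c] by simp
  next
    fix M assume M: "M \<in> Obj (D1 D)" "src1 D M = Y"
    show "square_coproduct (\<lambda>n. M \<odot> P n) (M \<odot> T) (\<lambda>n. hid D M \<circledast> \<iota> n) X (tgt1 D M)"
      using local_coproduct_is_square_coproduct[OF fib _ _ l[of M X ?J T \<iota>]] M c XY
      by (simp add: comp_fctr_def lwhisker_def comp_def)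
  next
    fix N assume N: "N \<in> Obj (D1 D)" "tgt1 D N = X"
    show "square_coproduct (\<lambda>n. P n \<odot> N) (T \<odot> N) (\<lambda>n. \<iota> n \<circledast> hid D N) (src1 D N) Y"
      using local_coproduct_is_square_coproduct[OF fib _ _ r[of N Y ?J T \<iota>]] N c XY
      by (simp add: comp_fctr_def rwhisker_def comp_def)
  next
    fix M N assume M: "M \<in> Obj (D1 D)" "src1 D M = Y" and N: "N \<in> Obj (D1 D)" "tgt1 D N = X"
    show "square_coproduct (\<lambda>n. (M \<odot> P n) \<odot> N) ((M \<odot> T) \<odot> N)
        (\<lambda>n. (hid D M \<circledast> \<iota> n) \<circledast> hid D N) (src1 D N) (tgt1 D M)"
      using local_coproduct_is_square_coproduct[OF fib _ _ r[OF N(1) _ _], of "tgt1 D M"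
          "comp_fctr (lwhisker D M) ?J" "M \<odot> T" "\<lambda>n. hid D M \<circledast> \<iota> n"] l[of M X ?J T \<iota>] M N c XY
      by (simp add: comp_fctr_def lwhisker_def rwhisker_def comp_def)
  qed
qed

end

section \<open>Left adjoints from universal arrows\<close>

text \<open>The functor is defined on arrows by the universal property, and each required
  equation holds because both sides have the same composite with a universal arrow.\<close>

lemma left_adjoint_from_universal_arrows:
  assumes "is_functor E C U"
    and univ: "\<And>c. c \<in> Obj C \<Longrightarrow> \<exists>e u. e \<in> Obj E \<and> in_hom C u c (omap U e) \<and>
      (\<forall>e'\<in>Obj E. \<forall>g. in_hom C g c (omap U e') \<longrightarrow> (\<exists>!h. in_hom E h e e' \<and> amap U h \<cdot>\<^bsub>C\<^esub> u = g))"
  shows "has_left_adjoint E C U"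
proof -
  interpret U: is_functor E C U by fact
  obtain F0 \<eta> where F0: "\<And>c. c \<in> Obj C \<Longrightarrow> F0 c \<in> Obj E"
    and eta: "\<And>c. c \<in> Obj C \<Longrightarrow> in_hom C (\<eta> c) c (omap U (F0 c))"
    and ex1: "\<And>c e g. \<lbrakk>c \<in> Obj C; e \<in> Obj E; in_hom C g c (omap U e)\<rbrakk> \<Longrightarrow>
      \<exists>!h. in_hom E h (F0 c) e \<and> amap U h \<cdot>\<^bsub>C\<^esub> \<eta> c = g"
    using univ by metis
  define tr where "tr c e g = (THE h. in_hom E h (F0 c) e \<and> amap U h \<cdot>\<^bsub>C\<^esub> \<eta> c = g)" for c e g
  have tr: "in_hom E (tr c e g) (F0 c) e" "amap U (tr c e g) \<cdot>\<^bsub>C\<^esub> \<eta> c = g"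
    if "c \<in> Obj C" "e \<in> Obj E" "in_hom C g c (omap U e)" for c e g
    using theI'[OF ex1[OF that]] by (simp_all add: tr_def)
  have eqI: "h = h'" if "in_hom E h (F0 c) e" "in_hom E h' (F0 c) e" "c \<in> Obj C" "e \<in> Obj E"
    "amap U h \<cdot>\<^bsub>C\<^esub> \<eta> c = amap U h' \<cdot>\<^bsub>C\<^esub> \<eta> c" for h h' c e
  proof -
    have "in_hom C (amap U h \<cdot>\<^bsub>C\<^esub> \<eta> c) c (omap U e)"
      using that eta[of c] by (auto simp: in_hom_def)
    from ex1[OF that(3,4) this] that show ?thesis by metis
  qed
  have etaD [simp]: "\<eta> c \<in> Arr C" "Dom C (\<eta> c) = c" "Cod C (\<eta> c) = omap U (F0 c)" "F0 c \<in> Obj E" if "c \<in> Obj C" for c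
    using eta[OF that] F0 that by (auto simp: in_hom_def)
  define F where "F = \<lparr>omap = F0, amap = (\<lambda>f. tr (Dom C f) (F0 (Cod C f)) (\<eta> (Cod C f) \<cdot>\<^bsub>C\<^esub> f))\<rparr>"
  have F_simps [simp]: "amap F f \<in> Arr E" "Dom E (amap F f) = F0 (Dom C f)" "Cod E (amap F f) = F0 (Cod C f)"
    and F_nat: "amap U (amap F f) \<cdot>\<^bsub>C\<^esub> \<eta> (Dom C f) = \<eta> (Cod C f) \<cdot>\<^bsub>C\<^esub> f" if "f \<in> Arr C" for f
    using tr[of "Dom C f" "F0 (Cod C f)" "\<eta> (Cod C f) \<cdot>\<^bsub>C\<^esub> f"] that by (auto simp: F_def in_hom_def)
  have [simp]: "omap F = F0" by (simp add: F_def)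
  interpret F: is_functor C E F
  proof
    fix f x y z g assume fg: "in_hom C f x y" "in_hom C g y z"
    hence [simp]: "f \<in> Arr C" "g \<in> Arr C" "Dom C f = x" "Cod C f = y" "Dom C g = y" "Cod C g = z"
      by (auto simp: in_hom_def)
    have [simp]: "x \<in> Obj C" "y \<in> Obj C" "z \<in> Obj C"
      using U.E.Dom_Cod_Obj[of f] U.E.Dom_Cod_Obj[of g] by simp_all
    show "amap F (g \<cdot>\<^bsub>C\<^esub> f) = amap F g \<cdot>\<^bsub>E\<^esub> amap F f"
    proof (rule eqI[of _ x "F0 z"])
      have "amap U (amap F g \<cdot>\<^bsub>E\<^esub> amap F f) \<cdot>\<^bsub>C\<^esub> \<eta> x = amap U (amap F g) \<cdot>\<^bsub>C\<^esub> \<eta> y \<cdot>\<^bsub>C\<^esub> f"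
        using F_nat[of f] by (simp add: U.E.assoc_Arr)
      also have "\<dots> = (amap U (amap F g) \<cdot>\<^bsub>C\<^esub> \<eta> y) \<cdot>\<^bsub>C\<^esub> f"
        by (simp add: U.E.assoc_Arr)
      also have "\<dots> = \<eta> z \<cdot>\<^bsub>C\<^esub> g \<cdot>\<^bsub>C\<^esub> f"
        using F_nat[of g] by (simp add: U.E.assoc_Arr)
      finally show "amap U (amap F (g \<cdot>\<^bsub>C\<^esub> f)) \<cdot>\<^bsub>C\<^esub> \<eta> x = amap U (amap F g \<cdot>\<^bsub>E\<^esub> amap F f) \<cdot>\<^bsub>C\<^esub> \<eta> x"
        using F_nat[of "g \<cdot>\<^bsub>C\<^esub> f"] by simp
    qed (simp_all add: in_hom_def)
  next
    fix x assume [simp]: "x \<in> Obj C"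
    show "amap F (Idn C x) = Idn E (omap F x)"
      by (rule eqI[of _ x "F0 x"]) (use F_nat[of "Idn C x"] in \<open>simp_all add: in_hom_def\<close>)
  qed (auto simp: in_hom_def)
  define \<epsilon> where "\<epsilon> e = tr (omap U e) e (Idn C (omap U e))" for e
  have eps [simp]: "\<epsilon> e \<in> Arr E" "Dom E (\<epsilon> e) = F0 (omap U e)" "Cod E (\<epsilon> e) = e"
    and eps_eta: "amap U (\<epsilon> e) \<cdot>\<^bsub>C\<^esub> \<eta> (omap U e) = Idn C (omap U e)" if "e \<in> Obj E" for e
    using tr[of "omap U e" e "Idn C (omap U e)"] that by (auto simp: \<epsilon>_def in_hom_def)
  have UF: "is_functor C C (comp_fctr U F)" and FU: "is_functor E E (comp_fctr F U)"
    and idC: "is_functor C C id_fctr" and idE: "is_functor E E id_fctr"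
    by (unfold_locales; auto simp: comp_fctr_def id_fctr_def in_hom_def)+
  have "nat_trans C C id_fctr (comp_fctr U F) \<eta>"
    unfolding nat_trans_def using idC UF F_nat by (auto simp: comp_fctr_def id_fctr_def in_hom_def)
  moreover have "nat_trans E E (comp_fctr F U) id_fctr \<epsilon>"
    unfolding nat_trans_def
  proof (intro conjI ballI)
    fix f assume [simp]: "f \<in> Arr E"
    let ?x = "Dom E f" and ?y = "Cod E f"
    have "\<epsilon> ?y \<cdot>\<^bsub>E\<^esub> amap F (amap U f) = f \<cdot>\<^bsub>E\<^esub> \<epsilon> ?x"
    proof (rule eqI[of _ "omap U ?x" ?y])
      have "amap U (\<epsilon> ?y \<cdot>\<^bsub>E\<^esub> amap F (amap U f)) \<cdot>\<^bsub>C\<^esub> \<eta> (omap U ?x) = amap U (\<epsilon> ?y) \<cdot>\<^bsub>C\<^esub> \<eta> (omap U ?y) \<cdot>\<^bsub>C\<^esub> amap U f"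
        using F_nat[of "amap U f"] by (simp add: U.E.assoc_Arr)
      also have "\<dots> = (amap U (\<epsilon> ?y) \<cdot>\<^bsub>C\<^esub> \<eta> (omap U ?y)) \<cdot>\<^bsub>C\<^esub> amap U f"
        by (simp add: U.E.assoc_Arr)
      also have "\<dots> = amap U (f \<cdot>\<^bsub>E\<^esub> \<epsilon> ?x) \<cdot>\<^bsub>C\<^esub> \<eta> (omap U ?x)"
        by (simp add: U.E.assoc_Arr eps_eta)
      finally show "amap U (\<epsilon> ?y \<cdot>\<^bsub>E\<^esub> amap F (amap U f)) \<cdot>\<^bsub>C\<^esub> \<eta> (omap U ?x) =
        amap U (f \<cdot>\<^bsub>E\<^esub> \<epsilon> ?x) \<cdot>\<^bsub>C\<^esub> \<eta> (omap U ?x)" .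
    qed (simp_all add: in_hom_def)
    thus "\<epsilon> (Cod E f) \<cdot>\<^bsub>E\<^esub> amap (comp_fctr F U) f = amap id_fctr f \<cdot>\<^bsub>E\<^esub> \<epsilon> (Dom E f)"
      by (simp add: comp_fctr_def id_fctr_def)
  qed (use idE FU in \<open>auto simp: comp_fctr_def id_fctr_def in_hom_def\<close>)
  moreover have "\<epsilon> (F0 c) \<cdot>\<^bsub>E\<^esub> amap F (\<eta> c) = Idn E (F0 c)" if [simp]: "c \<in> Obj C" for c
  proof (rule eqI[of _ c "F0 c"])
    have "amap U (\<epsilon> (F0 c) \<cdot>\<^bsub>E\<^esub> amap F (\<eta> c)) \<cdot>\<^bsub>C\<^esub> \<eta> c = amap U (\<epsilon> (F0 c)) \<cdot>\<^bsub>C\<^esub> \<eta> (omap U (F0 c)) \<cdot>\<^bsub>C\<^esub> \<eta> c"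
      using F_nat[of "\<eta> c"] by (simp add: U.E.assoc_Arr)
    also have "\<dots> = (amap U (\<epsilon> (F0 c)) \<cdot>\<^bsub>C\<^esub> \<eta> (omap U (F0 c))) \<cdot>\<^bsub>C\<^esub> \<eta> c"
      by (simp add: U.E.assoc_Arr)
    finally show "amap U (\<epsilon> (F0 c) \<cdot>\<^bsub>E\<^esub> amap F (\<eta> c)) \<cdot>\<^bsub>C\<^esub> \<eta> c = amap U (Idn E (F0 c)) \<cdot>\<^bsub>C\<^esub> \<eta> c"
      by (simp add: eps_eta)
  qed (simp_all add: in_hom_def)
  ultimately have "adjunction C E F U \<eta> \<epsilon>"
    unfolding adjunction_def using U.is_functor_axioms F.is_functor_axioms eps_eta by simp
  thus ?thesis unfolding has_left_adjoint_def by blast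
qed

section \<open>Monads and endo-1-cells\<close>

context double_category
begin

lemma monadD:
  assumes S: "is_monad D S" and A: "A = und S" and Y: "Y = src1 D A"
  shows "A \<in> Obj (D1 D)" "src1 D A = Y" "tgt1 D A = Y" "Y \<in> Obj (D0 D)"
    and "square (mult S) (A \<odot> A) A (Idn (D0 D) Y) (Idn (D0 D) Y)"
    and "square (unit S) (hunit1 D Y) A (Idn (D0 D) Y) (Idn (D0 D) Y)"
    and "mult S \<bullet> (mult S \<circledast> hid D A) = mult S \<bullet> (hid D A \<circledast> mult S) \<bullet> Assoc D A A A"
    and "mult S \<bullet> (unit S \<circledast> hid D A) = LUnit D A"
    and "mult S \<bullet> (hid D A \<circledast> unit S) = RUnit D A"
proof -
  have A1: "A \<in> Obj (D1 D)" and "src1 D A = tgt1 D A" using S A by (auto simp: is_monad_def Let_def)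
  hence A2: "src1 D A = Y" "tgt1 D A = Y" and A3: "Y \<in> Obj (D0 D)" using Y by auto
  have m: "in_hom (D1 D) (mult S) (A \<odot> A) A" "globular D (mult S)"
    and u: "in_hom (D1 D) (unit S) (hunit1 D Y) A" "globular D (unit S)"
    using S A Y by (auto simp: is_monad_def Let_def)
  show "A \<in> Obj (D1 D)" "src1 D A = Y" "tgt1 D A = Y" "Y \<in> Obj (D0 D)" by fact+
  show "square (mult S) (A \<odot> A) A (Idn (D0 D) Y) (Idn (D0 D) Y)"
    using m(2) unfolding globular_iff[OF m(1)] using m(1) A1 A2 by (simp add: square_def)
  show "square (unit S) (hunit1 D Y) A (Idn (D0 D) Y) (Idn (D0 D) Y)"
    using u(2) unfolding globular_iff[OF u(1)] using u(1) A3 by (simp add: square_def)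
  show "mult S \<bullet> (mult S \<circledast> hid D A) = mult S \<bullet> (hid D A \<circledast> mult S) \<bullet> Assoc D A A A"
    "mult S \<bullet> (unit S \<circledast> hid D A) = LUnit D A" "mult S \<bullet> (hid D A \<circledast> unit S) = RUnit D A"
    using S A by (auto simp: is_monad_def Let_def)
qed

lemma End_cat_simps [simp]:
  shows "M \<in> Obj (End_cat D) \<longleftrightarrow> M \<in> Obj (D1 D) \<and> src1 D M = tgt1 D M"
    and "\<alpha> \<in> Arr (End_cat D) \<longleftrightarrow> \<alpha> \<in> Arr (D1 D) \<and> src2 D \<alpha> = tgt2 D \<alpha>"
    and "Dom (End_cat D) = Dom (D1 D)" "Cod (End_cat D) = Cod (D1 D)"
    and "Idn (End_cat D) = Idn (D1 D)" "Comp (End_cat D) = Comp (D1 D)"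
  by (simp_all add: End_cat_def)

lemma category_End_cat: "category (End_cat D)"
proof
  fix f assume f: "f \<in> Arr (End_cat D)"
  thus "Dom (End_cat D) f \<in> Obj (End_cat D)" "Cod (End_cat D) f \<in> Obj (End_cat D)"
    using S.functor_simps(3,4)[of f] T.functor_simps(3,4)[of f] by auto
qed (auto simp: in_hom_def H.assoc_Arr)

lemma is_monad_morphism_comp:
  assumes mon: "is_monad D R" "is_monad D S" "is_monad D T"
    and al: "is_monad_morphism D R \<alpha> S" and be: "is_monad_morphism D S \<beta> T"
  shows "is_monad_morphism D R (\<beta> \<bullet> \<alpha>) T"
proof -
  obtain f where f: "square \<alpha> (und R) (und S) f f" "mult S \<bullet> (\<alpha> \<circledast> \<alpha>) = \<alpha> \<bullet> mult R"
      "\<alpha> \<bullet> unit R = unit S \<bullet> hunit2 D f"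
    using al by (auto simp: is_monad_morphism_def square_def)
  obtain g where g: "square \<beta> (und S) (und T) g g" "mult T \<bullet> (\<beta> \<circledast> \<beta>) = \<beta> \<bullet> mult S"
      "\<beta> \<bullet> unit S = unit T \<bullet> hunit2 D g"
    using be by (auto simp: is_monad_morphism_def square_def)
  note R = monadD[OF mon(1) refl refl] and S = monadD[OF mon(2) refl refl] and T = monadD[OF mon(3) refl refl]
  have fg: "Dom (D0 D) f = src1 D (und R)" "Cod (D0 D) f = src1 D (und S)"
    "Dom (D0 D) g = src1 D (und S)" "Cod (D0 D) g = src1 D (und T)"
    using squareD(10,11)[OF f(1)] squareD(10,11)[OF g(1)] by auto
  note [simp] = R(1,3,4) S(1,3,4) T(1,3,4) fg squareD(1-5,8)[OF f(1)] squareD(1-5,8)[OF g(1)]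
    globular_squareD(1-5)[OF R(5,4,4)] globular_squareD(1-5)[OF S(5,4,4)] globular_squareD(1-5)[OF T(5,4,4)]
    globular_squareD(1-5)[OF R(6,4,4)] globular_squareD(1-5)[OF S(6,4,4)] globular_squareD(1-5)[OF T(6,4,4)]
  have "mult T \<bullet> ((\<beta> \<bullet> \<alpha>) \<circledast> (\<beta> \<bullet> \<alpha>)) = (mult T \<bullet> (\<beta> \<circledast> \<beta>)) \<bullet> (\<alpha> \<circledast> \<alpha>)"
    by (simp add: H.assoc_Arr interchange)
  also have "\<dots> = (\<beta> \<bullet> \<alpha>) \<bullet> mult R"
    unfolding g(2) using f(2) by (simp add: H.assoc_Arr)
  finally have 1: "mult T \<bullet> ((\<beta> \<bullet> \<alpha>) \<circledast> (\<beta> \<bullet> \<alpha>)) = (\<beta> \<bullet> \<alpha>) \<bullet> mult R" .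
  have "(\<beta> \<bullet> \<alpha>) \<bullet> unit R = (\<beta> \<bullet> unit S) \<bullet> hunit2 D f"
    using f(3) by (simp add: H.assoc_Arr)
  also have "\<dots> = unit T \<bullet> hunit2 D (g \<cdot>\<^bsub>D0 D\<^esub> f)"
    unfolding g(3) by (simp add: H.assoc_Arr)
  finally show ?thesis using 1 by (simp add: is_monad_morphism_def in_hom_def)
qed

lemma is_monad_morphism_hid:
  assumes "is_monad D S"
  shows "is_monad_morphism D S (hid D (und S)) S"
proof -
  note S = monadD[OF assms refl refl]
  note [simp] = S(1,3,4) globular_squareD(1-5)[OF S(5,4,4)] globular_squareD(1-5)[OF S(6,4,4)]
  show ?thesis by (simp add: is_monad_morphism_def in_hom_def)
qed

lemma Mnd_cat_simps [simp]:
  shows "T \<in> Obj (Mnd_cat D) \<longleftrightarrow> is_monad D T"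
    and "(S, \<alpha>, T) \<in> Arr (Mnd_cat D) \<longleftrightarrow> is_monad D S \<and> is_monad D T \<and> is_monad_morphism D S \<alpha> T"
    and "Dom (Mnd_cat D) (S, \<alpha>, T) = S" "Cod (Mnd_cat D) (S, \<alpha>, T) = T"
    and "Idn (Mnd_cat D) T = (T, hid D (und T), T)"
    and "(S', \<beta>, T') \<cdot>\<^bsub>Mnd_cat D\<^esub> (S, \<alpha>, T) = (S, \<beta> \<bullet> \<alpha>, T')"
  by (simp_all add: Mnd_cat_def)

lemma is_functor_forget_mnd: "is_functor (Mnd_cat D) (End_cat D) (forget_mnd D)"
proof -
  have mor: "\<alpha> \<in> Arr (D1 D)" "Dom (D1 D) \<alpha> = und S" "Cod (D1 D) \<alpha> = und T" "src2 D \<alpha> = tgt2 D \<alpha>"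
    if "is_monad_morphism D S \<alpha> T" for S \<alpha> T
    using that by (auto simp: is_monad_morphism_def in_hom_def)
  have "category (Mnd_cat D)"
    by unfold_locales
      (auto simp: in_hom_def is_monad_morphism_hid mor H.assoc_Arr intro: is_monad_morphism_comp)
  moreover have "und S \<in> Obj (D1 D) \<and> src1 D (und S) = tgt1 D (und S)" if "is_monad D S" for S
    using that by (auto simp: is_monad_def Let_def)
  ultimately show ?thesis
    using category_End_cat
    by (auto simp: is_functor_def is_functor_axioms_def forget_mnd_def in_hom_def mor)
qed

end

section \<open>Free left actions of an endo-1-cell\<close>

text \<open>The last assumption says that \<open>T \<odot> N\<close> is the free left \<open>M\<close>-action on \<open>N\<close>, in a form suited to
  2-cells over vertical 1-cells: the target carries an action \<open>b\<close> of some \<open>B\<close>, restricted along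
  \<open>\<alpha> : M \<Rightarrow> B\<close>. An action in this sense obeys no laws, just as the generators of a free monad obey none.
  The arbitrary \<open>N\<close> on the right is what makes \<open>T \<odot> T\<close> and \<open>T \<odot> (T \<odot> T)\<close> accessible to recursion.\<close>

locale free_action = double_category D for D :: "('o, 'v, 'h, 'c) double_cat" (structure) +
  fixes X :: 'o and M T :: 'h and e a :: 'c
  assumes X [simp]: "X \<in> Obj (D0 D)"
    and M [simp]: "M \<in> Obj (D1 D)" "src1 D M = X" "tgt1 D M = X"
    and e_square: "square e (hunit1 D X) T (Idn (D0 D) X) (Idn (D0 D) X)"
    and a_square: "square a (M \<odot> T) T (Idn (D0 D) X) (Idn (D0 D) X)"
    and recursion: "\<lbrakk>N \<in> Obj (D1 D); tgt1 D N = X; square \<alpha> M B f f; square z N Z v f;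
        square b (B \<odot> Z) Z (Idn (D0 D) (Cod (D0 D) v)) (Idn (D0 D) (Cod (D0 D) f))\<rbrakk> \<Longrightarrow>
      \<exists>!k. square k (T \<odot> N) Z v f \<and> k \<bullet> (e \<circledast> hid D N) = z \<bullet> LUnit D N \<and>
        k \<bullet> (a \<circledast> hid D N) = b \<bullet> (\<alpha> \<circledast> k) \<bullet> Assoc D M T N"
begin

lemmas e_simps [simp] = globular_squareD[OF e_square X X]
lemmas a_simps [simp] = globular_squareD(1-5)[OF a_square X X]

text \<open>The case \<open>N = 1\<^sub>X\<close>, transported along the right unit constraint of \<open>T\<close>. It transports correctly
  because \<open>RUnit (M \<odot> T)\<close> is determined by \<open>RUnit T\<close> and because the two unit constraints of
  \<open>1\<^sub>X\<close> agree.\<close>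

lemma recursion_unit:
  assumes al: "square \<alpha> M B f f" and z: "square z (hunit1 D X) Z f f"
    and b: "square b (B \<odot> Z) Z (Idn (D0 D) (Cod (D0 D) f)) (Idn (D0 D) (Cod (D0 D) f))"
  shows "\<exists>!h. square h T Z f f \<and> h \<bullet> e = z \<and> h \<bullet> a = b \<bullet> (\<alpha> \<circledast> h)"
proof -
  let ?I = "hunit1 D X"
  have f: "Dom (D0 D) f = X" using squareD(10)[OF al] by simp
  note [simp] = squareD[OF al] squareD(1-9,11,13)[OF z] squareD(1-5)[OF b] f
  have R_a: "RUnit D T \<bullet> (a \<circledast> hid D ?I) = a \<bullet> RUnit D (M \<odot> T)"
    using RUnit_slide[of a T "Idn (D0 D) X"] by simp
  have R_e: "RUnit D T \<bullet> (e \<circledast> hid D ?I) = e \<bullet> RUnit D ?I"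
    using RUnit_slide[of e T "Idn (D0 D) X"] by simp
  have R_MT: "RUnit D (M \<odot> T) = (hid D M \<circledast> RUnit D T) \<bullet> Assoc D M T ?I"
    using RUnit_hcomp[of M T] by simp
  have transpose: "(h \<bullet> e = z \<longleftrightarrow> (h \<bullet> RUnit D T) \<bullet> (e \<circledast> hid D ?I) = z \<bullet> LUnit D ?I) \<and>
      (h \<bullet> a = b \<bullet> (\<alpha> \<circledast> h) \<longleftrightarrow>
        (h \<bullet> RUnit D T) \<bullet> (a \<circledast> hid D ?I) = b \<bullet> (\<alpha> \<circledast> (h \<bullet> RUnit D T)) \<bullet> Assoc D M T ?I)"
    if h: "square h T Z f f" for h
  proof -
    note [simp] = squareD(1-5)[OF h]
    have 1: "(h \<bullet> RUnit D T) \<bullet> (e \<circledast> hid D ?I) = (h \<bullet> e) \<bullet> RUnit D ?I"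
      using R_e by (simp add: H.assoc_Arr)
    have 2: "(h \<bullet> RUnit D T) \<bullet> (a \<circledast> hid D ?I) = (h \<bullet> a) \<bullet> RUnit D (M \<odot> T)"
      using R_a by (simp add: H.assoc_Arr)
    have 3: "b \<bullet> (\<alpha> \<circledast> (h \<bullet> RUnit D T)) \<bullet> Assoc D M T ?I = (b \<bullet> (\<alpha> \<circledast> h)) \<bullet> RUnit D (M \<odot> T)"
      by (simp add: R_MT H.assoc_Arr interchange_rest)
    have "h \<bullet> e = z" if "(h \<bullet> e) \<bullet> RUnit D ?I = z \<bullet> RUnit D ?I"
      by (rule H.iso_cancel_right[OF RUnit_iso[of ?I] _ _ _ _ that]) simp_all
    moreover have "h \<bullet> a = b \<bullet> (\<alpha> \<circledast> h)"
      if "(h \<bullet> a) \<bullet> RUnit D (M \<odot> T) = (b \<bullet> (\<alpha> \<circledast> h)) \<bullet> RUnit D (M \<odot> T)"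
      by (rule H.iso_cancel_right[OF RUnit_iso[of "M \<odot> T"] _ _ _ _ that]) simp_all
    ultimately show ?thesis unfolding 1 2 3 LUnit_hunit[OF X] by metis
  qed
  have rec: "\<exists>!k. square k (T \<odot> ?I) Z f f \<and> k \<bullet> (e \<circledast> hid D ?I) = z \<bullet> LUnit D ?I \<and>
        k \<bullet> (a \<circledast> hid D ?I) = b \<bullet> (\<alpha> \<circledast> k) \<bullet> Assoc D M T ?I"
    using recursion[OF _ _ al z b] by simp
  obtain R' where R': "R' \<in> Arr (D1 D)" "Dom (D1 D) R' = T" "Cod (D1 D) R' = T \<odot> ?I"
    "src2 D R' = Idn (D0 D) X" "tgt2 D R' = Idn (D0 D) X" "R' \<bullet> RUnit D T = hid D (T \<odot> ?I)"
    by (rule globular_iso_inverse[OF RUnit_iso[of T], of X X]) auto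
  show ?thesis
  proof (rule ex_ex1I)
    obtain k where k: "square k (T \<odot> ?I) Z f f" "k \<bullet> (e \<circledast> hid D ?I) = z \<bullet> LUnit D ?I"
        "k \<bullet> (a \<circledast> hid D ?I) = b \<bullet> (\<alpha> \<circledast> k) \<bullet> Assoc D M T ?I"
      using rec by blast
    note [simp] = squareD(1-5)[OF k(1)] R'
    have "square (k \<bullet> R') T Z f f" by (simp add: square_iff)
    moreover have "(k \<bullet> R') \<bullet> RUnit D T = k" by (simp add: H.assoc_Arr)
    ultimately show "\<exists>h. square h T Z f f \<and> h \<bullet> e = z \<and> h \<bullet> a = b \<bullet> (\<alpha> \<circledast> h)"
      using transpose[of "k \<bullet> R'"] k by metis
  next
    fix h h'
    assume h: "square h T Z f f \<and> h \<bullet> e = z \<and> h \<bullet> a = b \<bullet> (\<alpha> \<circledast> h)"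
      and h': "square h' T Z f f \<and> h' \<bullet> e = z \<and> h' \<bullet> a = b \<bullet> (\<alpha> \<circledast> h')"
    note [simp] = squareD(1-5)[OF conjunct1[OF h]] squareD(1-5)[OF conjunct1[OF h']]
    have "square (h \<bullet> RUnit D T) (T \<odot> ?I) Z f f" "square (h' \<bullet> RUnit D T) (T \<odot> ?I) Z f f"
      by (simp_all add: square_iff)
    hence eq: "h \<bullet> RUnit D T = h' \<bullet> RUnit D T"
      using transpose[of h] transpose[of h'] h h' rec by blast
    show "h = h'"
      by (rule H.iso_cancel_right[OF RUnit_iso[of T] _ _ _ _ eq]) simp_all
  qed
qed

section \<open>The free monad\<close>

text \<open>The identity factor is the value at \<open>N\<close> of the recursion: the definition is literally the
  instance \<open>N = T\<close>, \<open>z = id\<close>, \<open>\<alpha> = id\<close>, \<open>b = a\<close>.\<close>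

definition \<mu> :: 'c where
  "\<mu> = (THE k. square k (T \<odot> T) T (Idn (D0 D) X) (Idn (D0 D) X) \<and>
    k \<bullet> (e \<circledast> hid D T) = hid D T \<bullet> LUnit D T \<and>
    k \<bullet> (a \<circledast> hid D T) = a \<bullet> (hid D M \<circledast> k) \<bullet> Assoc D M T T)"

lemma \<mu>_props:
  shows \<mu>_square: "square \<mu> (T \<odot> T) T (Idn (D0 D) X) (Idn (D0 D) X)"
    and \<mu>_e: "\<mu> \<bullet> (e \<circledast> hid D T) = LUnit D T"
    and \<mu>_a: "\<mu> \<bullet> (a \<circledast> hid D T) = a \<bullet> (hid D M \<circledast> \<mu>) \<bullet> Assoc D M T T"
proof -
  have "\<exists>!k. square k (T \<odot> T) T (Idn (D0 D) X) (Idn (D0 D) X) \<and>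
    k \<bullet> (e \<circledast> hid D T) = hid D T \<bullet> LUnit D T \<and>
    k \<bullet> (a \<circledast> hid D T) = a \<bullet> (hid D M \<circledast> k) \<bullet> Assoc D M T T"
    by (rule recursion[where B = M and f = "Idn (D0 D) X"]) (use a_square in \<open>simp_all add: square_iff\<close>)
  from theI'[OF this]
  show "square \<mu> (T \<odot> T) T (Idn (D0 D) X) (Idn (D0 D) X)"
    "\<mu> \<bullet> (e \<circledast> hid D T) = LUnit D T"
    "\<mu> \<bullet> (a \<circledast> hid D T) = a \<bullet> (hid D M \<circledast> \<mu>) \<bullet> Assoc D M T T"
    by (simp_all add: \<mu>_def)
qed

lemmas \<mu>_simps [simp] = globular_squareD(1-5)[OF \<mu>_square X X]

text \<open>Both sides, read as 2-cells out of \<open>T \<odot> (T \<odot> T)\<close>, solve the recursion with \<open>N = T \<odot> T\<close>,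
  \<open>z = \<mu>\<close> and \<open>b = a\<close>. For the left-hand side \<open>j\<close> this means composing with the inverse \<open>B\<close> of the
  associator; the two equations for \<open>j B\<close> are checked after cancelling an associator on the right, where
  they come down to \<open>LUnit_hcomp\<close> and the pentagon.\<close>

lemma \<mu>_assoc: "\<mu> \<bullet> (\<mu> \<circledast> hid D T) = \<mu> \<bullet> (hid D T \<circledast> \<mu>) \<bullet> Assoc D T T T"
proof -
  let ?I = "hunit1 D X"
  obtain B where [simp]: "B \<in> Arr (D1 D)" "Dom (D1 D) B = T \<odot> (T \<odot> T)" "Cod (D1 D) B = (T \<odot> T) \<odot> T"
    "src2 D B = Idn (D0 D) X" "tgt2 D B = Idn (D0 D) X"
    and BA: "B \<bullet> Assoc D T T T = hid D ((T \<odot> T) \<odot> T)" and AB: "Assoc D T T T \<bullet> B = hid D (T \<odot> (T \<odot> T))"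
    by (rule globular_iso_inverse[OF Assoc_iso[of T T T], of X X]) auto
  define j where "j = \<mu> \<bullet> (\<mu> \<circledast> hid D T)"
  have [simp]: "j \<in> Arr (D1 D)" "Dom (D1 D) j = (T \<odot> T) \<odot> T" "Cod (D1 D) j = T"
    "src2 D j = Idn (D0 D) X" "tgt2 D j = Idn (D0 D) X" by (simp_all add: j_def)
  have slide: "B \<bullet> (\<gamma> \<circledast> hid D (T \<odot> T)) \<bullet> Assoc D Q T T = (\<gamma> \<circledast> hid D T) \<circledast> hid D T"
    if [simp]: "\<gamma> \<in> Arr (D1 D)" "Dom (D1 D) \<gamma> = Q" "Cod (D1 D) \<gamma> = T"
      "src2 D \<gamma> = Idn (D0 D) X" "tgt2 D \<gamma> = Idn (D0 D) X" "Q \<in> Obj (D1 D)" "src1 D Q = X" for \<gamma> Q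
  proof -
    have "B \<bullet> (\<gamma> \<circledast> hid D (T \<odot> T)) \<bullet> Assoc D Q T T = B \<bullet> (Assoc D T T T \<bullet> ((\<gamma> \<circledast> hid D T) \<circledast> hid D T))"
      by (simp add: Assoc_slide)
    also have "\<dots> = (B \<bullet> Assoc D T T T) \<bullet> ((\<gamma> \<circledast> hid D T) \<circledast> hid D T)"
      by (simp add: H.assoc_Arr)
    finally show ?thesis by (simp add: BA)
  qed
  have rec: "\<exists>!k. square k (T \<odot> (T \<odot> T)) T (Idn (D0 D) X) (Idn (D0 D) X) \<and>
    k \<bullet> (e \<circledast> hid D (T \<odot> T)) = \<mu> \<bullet> LUnit D (T \<odot> T) \<and>
    k \<bullet> (a \<circledast> hid D (T \<odot> T)) = a \<bullet> (hid D M \<circledast> k) \<bullet> Assoc D M T (T \<odot> T)"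
    by (rule recursion[where B = M and f = "Idn (D0 D) X"]) (use a_square \<mu>_square in \<open>simp_all add: square_iff\<close>)
  have l1: "(j \<bullet> B) \<bullet> (e \<circledast> hid D (T \<odot> T)) = \<mu> \<bullet> LUnit D (T \<odot> T)"
  proof (rule H.iso_cancel_right[OF Assoc_iso[of ?I T T]])
    have "((j \<bullet> B) \<bullet> (e \<circledast> hid D (T \<odot> T))) \<bullet> Assoc D ?I T T = j \<bullet> ((e \<circledast> hid D T) \<circledast> hid D T)"
      using slide[of e ?I] by (simp add: H.assoc_Arr)
    also have "\<dots> = \<mu> \<bullet> (LUnit D T \<circledast> hid D T)"
      by (simp add: j_def H.assoc_Arr interchange \<mu>_e)
    also have "\<dots> = (\<mu> \<bullet> LUnit D (T \<odot> T)) \<bullet> Assoc D ?I T T"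
      using LUnit_hcomp[of T T] by (simp add: H.assoc_Arr)
    finally show "((j \<bullet> B) \<bullet> (e \<circledast> hid D (T \<odot> T))) \<bullet> Assoc D ?I T T = (\<mu> \<bullet> LUnit D (T \<odot> T)) \<bullet> Assoc D ?I T T" .
  qed simp_all
  have l2: "(j \<bullet> B) \<bullet> (a \<circledast> hid D (T \<odot> T)) = a \<bullet> (hid D M \<circledast> (j \<bullet> B)) \<bullet> Assoc D M T (T \<odot> T)"
  proof (rule H.iso_cancel_right[OF Assoc_iso[of "M \<odot> T" T T]])
    have "((j \<bullet> B) \<bullet> (a \<circledast> hid D (T \<odot> T))) \<bullet> Assoc D (M \<odot> T) T T = j \<bullet> ((a \<circledast> hid D T) \<circledast> hid D T)"
      using slide[of a "M \<odot> T"] by (simp add: H.assoc_Arr)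
    also have "\<dots> = \<mu> \<bullet> ((\<mu> \<bullet> (a \<circledast> hid D T)) \<circledast> hid D T)"
      by (simp add: j_def H.assoc_Arr interchange)
    also have "\<dots> = (\<mu> \<bullet> (a \<circledast> hid D T)) \<bullet> ((hid D M \<circledast> \<mu>) \<circledast> hid D T) \<bullet> (Assoc D M T T \<circledast> hid D T)"
      unfolding \<mu>_a by (simp add: H.assoc_Arr interchange \<mu>_a[symmetric] interchange_rest)
    also have "\<dots> = a \<bullet> (hid D M \<circledast> \<mu>) \<bullet> (Assoc D M T T \<bullet> ((hid D M \<circledast> \<mu>) \<circledast> hid D T)) \<bullet> (Assoc D M T T \<circledast> hid D T)"
      unfolding \<mu>_a by (simp add: H.assoc_Arr)
    also have "\<dots> = a \<bullet> (hid D M \<circledast> j) \<bullet> Assoc D M (T \<odot> T) T \<bullet> (Assoc D M T T \<circledast> hid D T)"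
      by (simp add: Assoc_slide H.assoc_Arr interchange_rest j_def)
    also have "\<dots> = a \<bullet> (hid D M \<circledast> ((j \<bullet> B) \<bullet> Assoc D T T T)) \<bullet> Assoc D M (T \<odot> T) T \<bullet> (Assoc D M T T \<circledast> hid D T)"
      by (simp add: H.assoc_Arr BA)
    also have "\<dots> = a \<bullet> (hid D M \<circledast> (j \<bullet> B)) \<bullet> ((hid D M \<circledast> Assoc D T T T) \<bullet> Assoc D M (T \<odot> T) T \<bullet> (Assoc D M T T \<circledast> hid D T))"
      by (simp add: interchange_rest)
    also have "\<dots> = (a \<bullet> (hid D M \<circledast> (j \<bullet> B)) \<bullet> Assoc D M T (T \<odot> T)) \<bullet> Assoc D (M \<odot> T) T T"
      using pentagon[of M T T T] by (simp add: H.assoc_Arr)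
    finally show "((j \<bullet> B) \<bullet> (a \<circledast> hid D (T \<odot> T))) \<bullet> Assoc D (M \<odot> T) T T =
      (a \<bullet> (hid D M \<circledast> (j \<bullet> B)) \<bullet> Assoc D M T (T \<odot> T)) \<bullet> Assoc D (M \<odot> T) T T" .
  qed simp_all
  let ?r = "\<mu> \<bullet> (hid D T \<circledast> \<mu>)"
  have r1: "?r \<bullet> (e \<circledast> hid D (T \<odot> T)) = \<mu> \<bullet> LUnit D (T \<odot> T)"
  proof -
    have "?r \<bullet> (e \<circledast> hid D (T \<odot> T)) = (\<mu> \<bullet> (e \<circledast> hid D T)) \<bullet> (hid D ?I \<circledast> \<mu>)"
      by (simp add: H.assoc_Arr interchange)
    also have "\<dots> = \<mu> \<bullet> LUnit D (T \<odot> T)"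
      using LUnit_slide[of \<mu> T "Idn (D0 D) X"] by (simp add: \<mu>_e)
    finally show ?thesis .
  qed
  have r2: "?r \<bullet> (a \<circledast> hid D (T \<odot> T)) = a \<bullet> (hid D M \<circledast> ?r) \<bullet> Assoc D M T (T \<odot> T)"
  proof -
    have "?r \<bullet> (a \<circledast> hid D (T \<odot> T)) = (\<mu> \<bullet> (a \<circledast> hid D T)) \<bullet> (hid D (M \<odot> T) \<circledast> \<mu>)"
      by (simp add: H.assoc_Arr interchange)
    also have "\<dots> = a \<bullet> (hid D M \<circledast> \<mu>) \<bullet> (Assoc D M T T \<bullet> ((hid D M \<circledast> hid D T) \<circledast> \<mu>))"
      unfolding \<mu>_a by (simp add: H.assoc_Arr)
    also have "\<dots> = a \<bullet> (hid D M \<circledast> \<mu>) \<bullet> ((hid D M \<circledast> (hid D T \<circledast> \<mu>)) \<bullet> Assoc D M T (T \<odot> T))"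
      by (subst Assoc_slide) simp_all
    also have "\<dots> = a \<bullet> (hid D M \<circledast> ?r) \<bullet> Assoc D M T (T \<odot> T)"
      by (simp add: interchange_rest)
    finally show ?thesis .
  qed
  have "j \<bullet> B = ?r"
  proof -
    have "square (j \<bullet> B) (T \<odot> (T \<odot> T)) T (Idn (D0 D) X) (Idn (D0 D) X)"
      "square ?r (T \<odot> (T \<odot> T)) T (Idn (D0 D) X) (Idn (D0 D) X)"
      by (simp_all add: square_iff)
    thus ?thesis using rec l1 l2 r1 r2 by blast
  qed
  hence "(j \<bullet> B) \<bullet> Assoc D T T T = ?r \<bullet> Assoc D T T T" by (rule arg_cong)
  thus ?thesis by (simp add: H.assoc_Arr BA) (simp add: j_def)
qed

text \<open>Both sides solve the recursion with \<open>N = 1\<^sub>X\<close>, \<open>z = e\<close> and \<open>b = a\<close>.\<close>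

lemma \<mu>_right_unit: "\<mu> \<bullet> (hid D T \<circledast> e) = RUnit D T"
proof -
  let ?I = "hunit1 D X"
  have rec: "\<exists>!k. square k (T \<odot> ?I) T (Idn (D0 D) X) (Idn (D0 D) X) \<and>
    k \<bullet> (e \<circledast> hid D ?I) = e \<bullet> LUnit D ?I \<and>
    k \<bullet> (a \<circledast> hid D ?I) = a \<bullet> (hid D M \<circledast> k) \<bullet> Assoc D M T ?I"
    by (rule recursion[where B = M and f = "Idn (D0 D) X"]) (use a_square e_square in \<open>simp_all add: square_iff\<close>)
  have R1: "RUnit D T \<bullet> (e \<circledast> hid D ?I) = e \<bullet> LUnit D ?I"
    using RUnit_slide[of e T "Idn (D0 D) X"] by (simp add: LUnit_hunit)
  have R2: "RUnit D T \<bullet> (a \<circledast> hid D ?I) = a \<bullet> (hid D M \<circledast> RUnit D T) \<bullet> Assoc D M T ?I"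
    using RUnit_slide[of a T "Idn (D0 D) X"] RUnit_hcomp[of M T] by simp
  let ?r = "\<mu> \<bullet> (hid D T \<circledast> e)"
  have r1: "?r \<bullet> (e \<circledast> hid D ?I) = e \<bullet> LUnit D ?I"
  proof -
    have "?r \<bullet> (e \<circledast> hid D ?I) = (\<mu> \<bullet> (e \<circledast> hid D T)) \<bullet> (hid D ?I \<circledast> e)"
      by (simp add: H.assoc_Arr interchange)
    thus ?thesis
      using LUnit_slide[of e T "Idn (D0 D) X"] by (simp add: \<mu>_e)
  qed
  have r2: "?r \<bullet> (a \<circledast> hid D ?I) = a \<bullet> (hid D M \<circledast> ?r) \<bullet> Assoc D M T ?I"
  proof -
    have "?r \<bullet> (a \<circledast> hid D ?I) = (\<mu> \<bullet> (a \<circledast> hid D T)) \<bullet> (hid D (M \<odot> T) \<circledast> e)"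
      by (simp add: H.assoc_Arr interchange)
    also have "\<dots> = a \<bullet> (hid D M \<circledast> \<mu>) \<bullet> (Assoc D M T T \<bullet> ((hid D M \<circledast> hid D T) \<circledast> e))"
      unfolding \<mu>_a by (simp add: H.assoc_Arr)
    also have "\<dots> = a \<bullet> (hid D M \<circledast> \<mu>) \<bullet> ((hid D M \<circledast> (hid D T \<circledast> e)) \<bullet> Assoc D M T ?I)"
      by (subst Assoc_slide) simp_all
    also have "\<dots> = a \<bullet> (hid D M \<circledast> ?r) \<bullet> Assoc D M T ?I"
      by (simp add: interchange_rest)
    finally show ?thesis .
  qed
  have "square ?r (T \<odot> ?I) T (Idn (D0 D) X) (Idn (D0 D) X)"
    "square (RUnit D T) (T \<odot> ?I) T (Idn (D0 D) X) (Idn (D0 D) X)"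
    by (simp_all add: square_iff)
  thus ?thesis using rec r1 r2 R1 R2 by blast
qed

definition free_monad :: "('h, 'c) mnd" where
  "free_monad = \<lparr>und = T, mult = \<mu>, unit = e\<rparr>"

lemma free_monad_simps [simp]:
  "und free_monad = T" "mult free_monad = \<mu>" "unit free_monad = e"
  by (simp_all add: free_monad_def)

lemma is_monad_free_monad: "is_monad D free_monad"
proof -
  have "in_hom (D1 D) \<mu> (T \<odot> T) T" "in_hom (D1 D) e (hunit1 D X) T"
    by (simp_all add: in_hom_def)
  thus ?thesis
    using \<mu>_assoc \<mu>_e \<mu>_right_unit globular_iff[of \<mu> "T \<odot> T" T] globular_iff[of e "hunit1 D X" T]
    by (simp add: is_monad_def Let_def)
qed

text \<open>The universal arrow \<open>u\<close> is characterized by its composite with the right unit constraint, to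
  avoid naming the inverse of that constraint.\<close>

lemma generator_exists:
  obtains u where "square u M T (Idn (D0 D) X) (Idn (D0 D) X)"
    and "u \<bullet> RUnit D M = a \<bullet> (hid D M \<circledast> e)"
proof -
  let ?I = "hunit1 D X"
  obtain R where [simp]: "R \<in> Arr (D1 D)" "Dom (D1 D) R = M" "Cod (D1 D) R = M \<odot> ?I"
    "src2 D R = Idn (D0 D) X" "tgt2 D R = Idn (D0 D) X" and R: "R \<bullet> RUnit D M = hid D (M \<odot> ?I)"
    by (rule globular_iso_inverse[OF RUnit_iso[of M], of X X]) auto
  show thesis
    by (rule that[of "(a \<bullet> (hid D M \<circledast> e)) \<bullet> R"]) (simp_all add: square_iff H.assoc_Arr R)
qed

text \<open>The action of \<open>M\<close> on \<open>T\<close> is multiplication by generators. This is why a monad morphism is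
  determined by its restriction along \<open>u\<close>.\<close>

lemma action_by_generator:
  assumes u: "square u M T (Idn (D0 D) X) (Idn (D0 D) X)" "u \<bullet> RUnit D M = a \<bullet> (hid D M \<circledast> e)"
  shows "\<mu> \<bullet> (u \<circledast> hid D T) = a"
proof -
  note [simp] = globular_squareD(1-5)[OF u(1) X X]
  let ?I = "hunit1 D X"
  show ?thesis
  proof (rule H.iso_cancel_right[of "RUnit D M \<circledast> hid D T"])
    have "(\<mu> \<bullet> (u \<circledast> hid D T)) \<bullet> (RUnit D M \<circledast> hid D T) = \<mu> \<bullet> ((a \<bullet> (hid D M \<circledast> e)) \<circledast> hid D T)"
      by (simp add: H.assoc_Arr interchange u(2))
    also have "\<dots> = (\<mu> \<bullet> (a \<circledast> hid D T)) \<bullet> ((hid D M \<circledast> e) \<circledast> hid D T)"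
      by (simp add: H.assoc_Arr interchange)
    also have "\<dots> = a \<bullet> (hid D M \<circledast> \<mu>) \<bullet> (Assoc D M T T \<bullet> ((hid D M \<circledast> e) \<circledast> hid D T))"
      unfolding \<mu>_a by (simp add: H.assoc_Arr)
    also have "\<dots> = a \<bullet> (hid D M \<circledast> \<mu>) \<bullet> (hid D M \<circledast> (e \<circledast> hid D T)) \<bullet> Assoc D M ?I T"
      by (subst Assoc_slide) simp_all
    also have "\<dots> = a \<bullet> (RUnit D M \<circledast> hid D T)"
      using triangle[of M T] by (simp add: interchange_rest \<mu>_e)
    finally show "(\<mu> \<bullet> (u \<circledast> hid D T)) \<bullet> (RUnit D M \<circledast> hid D T) = a \<bullet> (RUnit D M \<circledast> hid D T)" .
  qed (auto intro!: iso_rwhisker[of _ X X] RUnit_iso)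
qed

text \<open>The monad morphisms \<open>h\<close> with \<open>h u = \<alpha>\<close> are the solutions of the recursion
  \<open>h e = \<eta>\<^sub>S 1\<^sub>f\<close>, \<open>h a = \<mu>\<^sub>S (\<alpha> \<odot> h)\<close>, which has exactly one solution. For existence,
  \<open>h \<mu>\<close> and \<open>\<mu>\<^sub>S (h \<odot> h)\<close> are compared as solutions of the recursion with \<open>N = T\<close> and \<open>z = h\<close>.\<close>

lemma free_monad_universal:
  assumes u: "square u M T (Idn (D0 D) X) (Idn (D0 D) X)" "u \<bullet> RUnit D M = a \<bullet> (hid D M \<circledast> e)"
    and S: "is_monad D S" and al: "square \<alpha> M (und S) f f"
  shows "\<exists>!h. is_monad_morphism D free_monad h S \<and> h \<bullet> u = \<alpha>"
proof -
  define B where "B = und S"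
  define Y where "Y = src1 D B"
  define m where "m = mult S"
  define i where "i = unit S"
  note Sm = monadD[OF S B_def Y_def, folded m_def i_def]
  have Bf: "Dom (D0 D) f = X" "Cod (D0 D) f = Y"
    using squareD(10,11)[OF al] B_def Y_def by auto
  note [simp] = Sm(1-4) globular_squareD(1-5)[OF Sm(5,4,4)] globular_squareD(1-5)[OF Sm(6,4,4)]
    globular_squareD(1-5)[OF u(1) X X] Bf
  have al': "square \<alpha> M B f f" using al by (simp add: B_def)
  note [simp] = squareD(1-5,8)[OF al']
  let ?I = "hunit1 D X"
  have rec: "\<exists>!h. square h T B f f \<and> h \<bullet> e = i \<bullet> hunit2 D f \<and> h \<bullet> a = m \<bullet> (\<alpha> \<circledast> h)"
    by (rule recursion_unit[OF al']) (use Sm(5) in \<open>simp_all add: square_iff\<close>)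
  \<comment> \<open>The right-hand side equals \<open>\<alpha> \<bullet> RUnit D M\<close> by the right unit law of \<open>S\<close>.\<close>
  have u_conv: "h \<bullet> u = \<alpha> \<longleftrightarrow> h \<bullet> a \<bullet> (hid D M \<circledast> e) = m \<bullet> (\<alpha> \<circledast> (i \<bullet> hunit2 D f))"
    if h: "square h T B f f" for h
  proof -
    note [simp] = squareD(1-5)[OF h]
    have "m \<bullet> (\<alpha> \<circledast> (i \<bullet> hunit2 D f)) = (m \<bullet> (hid D B \<circledast> i)) \<bullet> (\<alpha> \<circledast> hunit2 D f)"
      by (simp add: H.assoc_Arr interchange)
    also have "\<dots> = \<alpha> \<bullet> RUnit D M"
      using RUnit_slide[of \<alpha> B f] by (simp add: Sm(9))
    finally have 1: "m \<bullet> (\<alpha> \<circledast> (i \<bullet> hunit2 D f)) = \<alpha> \<bullet> RUnit D M" .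
    have 2: "h \<bullet> a \<bullet> (hid D M \<circledast> e) = (h \<bullet> u) \<bullet> RUnit D M"
      by (simp add: H.assoc_Arr u(2))
    have "h \<bullet> u = \<alpha>" if "(h \<bullet> u) \<bullet> RUnit D M = \<alpha> \<bullet> RUnit D M"
      by (rule H.iso_cancel_right[OF RUnit_iso[of M] _ _ _ _ that]) simp_all
    thus ?thesis unfolding 1 2 by blast
  qed
  have mor_iff: "is_monad_morphism D free_monad h S \<longleftrightarrow> (\<exists>g. square h T B g g \<and>
      m \<bullet> (h \<circledast> h) = h \<bullet> \<mu> \<and> h \<bullet> e = i \<bullet> hunit2 D g)" for h
    by (auto simp: is_monad_morphism_def square_def B_def m_def i_def)
  show ?thesis
  proof (rule ex_ex1I)
    obtain h where h: "square h T B f f" and he: "h \<bullet> e = i \<bullet> hunit2 D f" and ha: "h \<bullet> a = m \<bullet> (\<alpha> \<circledast> h)"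
      using rec by blast
    note [simp] = squareD(1-5)[OF h]
    have recT: "\<exists>!k. square k (T \<odot> T) B f f \<and> k \<bullet> (e \<circledast> hid D T) = h \<bullet> LUnit D T \<and>
        k \<bullet> (a \<circledast> hid D T) = m \<bullet> (\<alpha> \<circledast> k) \<bullet> Assoc D M T T"
      by (rule recursion[OF _ _ al' h]) (use Sm(5) in \<open>simp_all add: square_iff\<close>)
    have l1: "(h \<bullet> \<mu>) \<bullet> (e \<circledast> hid D T) = h \<bullet> LUnit D T"
      by (simp add: H.assoc_Arr \<mu>_e)
    have l2: "(h \<bullet> \<mu>) \<bullet> (a \<circledast> hid D T) = m \<bullet> (\<alpha> \<circledast> (h \<bullet> \<mu>)) \<bullet> Assoc D M T T"
    proof -
      have "(h \<bullet> \<mu>) \<bullet> (a \<circledast> hid D T) = (h \<bullet> a) \<bullet> (hid D M \<circledast> \<mu>) \<bullet> Assoc D M T T"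
        by (simp add: H.assoc_Arr \<mu>_a)
      thus ?thesis unfolding ha by (simp add: H.assoc_Arr interchange_rest)
    qed
    have r1: "(m \<bullet> (h \<circledast> h)) \<bullet> (e \<circledast> hid D T) = h \<bullet> LUnit D T"
    proof -
      have "(m \<bullet> (h \<circledast> h)) \<bullet> (e \<circledast> hid D T) = m \<bullet> ((i \<bullet> hunit2 D f) \<circledast> h)"
        by (simp add: H.assoc_Arr interchange he)
      also have "\<dots> = (m \<bullet> (i \<circledast> hid D B)) \<bullet> (hunit2 D f \<circledast> h)"
        by (simp add: H.assoc_Arr interchange)
      finally show ?thesis
        using LUnit_slide[of h B f] by (simp add: Sm(8))
    qed
    have r2: "(m \<bullet> (h \<circledast> h)) \<bullet> (a \<circledast> hid D T) = m \<bullet> (\<alpha> \<circledast> (m \<bullet> (h \<circledast> h))) \<bullet> Assoc D M T T"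
    proof -
      have "(m \<bullet> (h \<circledast> h)) \<bullet> (a \<circledast> hid D T) = m \<bullet> ((m \<bullet> (\<alpha> \<circledast> h)) \<circledast> h)"
        by (simp add: H.assoc_Arr interchange ha)
      also have "\<dots> = (m \<bullet> (m \<circledast> hid D B)) \<bullet> ((\<alpha> \<circledast> h) \<circledast> h)"
        by (simp add: H.assoc_Arr interchange)
      also have "\<dots> = m \<bullet> (hid D B \<circledast> m) \<bullet> (Assoc D B B B \<bullet> ((\<alpha> \<circledast> h) \<circledast> h))"
        unfolding Sm(7) by (simp add: H.assoc_Arr)
      also have "\<dots> = m \<bullet> (hid D B \<circledast> m) \<bullet> ((\<alpha> \<circledast> (h \<circledast> h)) \<bullet> Assoc D M T T)"
        by (subst Assoc_slide) simp_all
      finally show ?thesis by (simp add: interchange_rest)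
    qed
    have "square (h \<bullet> \<mu>) (T \<odot> T) B f f" "square (m \<bullet> (h \<circledast> h)) (T \<odot> T) B f f"
      by (simp_all add: square_iff)
    hence "m \<bullet> (h \<circledast> h) = h \<bullet> \<mu>" using recT l1 l2 r1 r2 by blast
    hence "is_monad_morphism D free_monad h S"
      unfolding mor_iff using h he by blast
    moreover have "h \<bullet> u = \<alpha>"
    proof -
      have "h \<bullet> a \<bullet> (hid D M \<circledast> e) = (h \<bullet> a) \<bullet> (hid D M \<circledast> e)"
        by (simp add: H.assoc_Arr)
      also have "\<dots> = m \<bullet> (\<alpha> \<circledast> (i \<bullet> hunit2 D f))"
        unfolding ha by (simp add: H.assoc_Arr interchange he)
      finally show ?thesis using u_conv[OF h] by blast
    qed
    ultimately show "\<exists>h. is_monad_morphism D free_monad h S \<and> h \<bullet> u = \<alpha>" by blast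
  next
    fix h h'
    assume hh: "is_monad_morphism D free_monad h S \<and> h \<bullet> u = \<alpha>" "is_monad_morphism D free_monad h' S \<and> h' \<bullet> u = \<alpha>"
    \<comment> \<open>A monad morphism lies over some \<open>g\<close>; globularity of \<open>u\<close> forces \<open>g = f\<close>.\<close>
    have char: "square h T B f f \<and> h \<bullet> e = i \<bullet> hunit2 D f \<and> h \<bullet> a = m \<bullet> (\<alpha> \<circledast> h)"
      if hm: "is_monad_morphism D free_monad h S" and hu: "h \<bullet> u = \<alpha>" for h
    proof -
      obtain g where g: "square h T B g g" "m \<bullet> (h \<circledast> h) = h \<bullet> \<mu>" "h \<bullet> e = i \<bullet> hunit2 D g"
        using hm mor_iff by blast
      have "Dom (D0 D) g = X" using squareD(10)[OF g(1)] by simp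
      note [simp] = squareD(1-5,8)[OF g(1)] this
      have "src2 D (h \<bullet> u) = g" by simp
      hence gf: "g = f" unfolding hu by simp
      have "h \<bullet> a = h \<bullet> \<mu> \<bullet> (u \<circledast> hid D T)" by (simp add: action_by_generator[OF u])
      also have "\<dots> = (m \<bullet> (h \<circledast> h)) \<bullet> (u \<circledast> hid D T)" unfolding g(2) by (simp add: H.assoc_Arr)
      also have "\<dots> = m \<bullet> (\<alpha> \<circledast> h)" using squareD(11)[OF g(1)] by (simp add: H.assoc_Arr interchange hu)
      finally show ?thesis using g gf by simp
    qed
    show "h = h'" using rec char hh by blast
  qed
qed

end

section \<open>Construction of free left actions\<close>

context double_category
begin

primrec tensor_power :: "'o \<Rightarrow> 'h \<Rightarrow> nat \<Rightarrow> 'h" where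
  "tensor_power X M 0 = hunit1 D X"
| "tensor_power X M (Suc n) = M \<odot> tensor_power X M n"

text \<open>The two equations of the recursion say that the components \<open>k (\<iota>\<^sub>n \<odot> N)\<close> form the sequence
  \<open>\<kappa>\<close> with \<open>\<kappa>\<^sub>0 = z \<bullet> LUnit N\<close> and \<open>\<kappa>\<^sub>n\<^sub>+\<^sub>1 = b (\<alpha> \<odot> \<kappa>\<^sub>n)\<close>: the step equation may be tested on the
  summands \<open>(M \<odot> P\<^sub>n) \<odot> N\<close>, on which \<open>a\<close> is \<open>\<iota>\<^sub>n\<^sub>+\<^sub>1\<close>. So the recursion is the universal property of the
  coproduct \<open>T \<odot> N\<close>.\<close>

lemma free_action_exists:
  assumes fib: "fibrant D" and stab: "stable_local_countable_coproducts D"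
    and M: "M \<in> Obj (D1 D)" "src1 D M = X" "tgt1 D M = X"
  shows "\<exists>T e a. free_action D X M T e a"
proof -
  have X: "X \<in> Obj (D0 D)" using M by auto
  note [simp] = M X
  define P where "P = tensor_power X M"
  have P0 [simp]: "P 0 = hunit1 D X" and PSuc [simp]: "P (Suc n) = M \<odot> P n" for n by (simp_all add: P_def)
  have P [simp]: "P n \<in> Obj (D1 D) \<and> src1 D (P n) = X \<and> tgt1 D (P n) = X" for n
    by (induction n) simp_all
  obtain T \<iota> where
    c: "square_coproduct P T \<iota> X X"
    and cM: "square_coproduct (\<lambda>n. M \<odot> P n) (M \<odot> T) (\<lambda>n. hid D M \<circledast> \<iota> n) X X"
    and cN: "\<And>N. \<lbrakk>N \<in> Obj (D1 D); tgt1 D N = X\<rbrakk> \<Longrightarrow>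
      square_coproduct (\<lambda>n. P n \<odot> N) (T \<odot> N) (\<lambda>n. \<iota> n \<circledast> hid D N) (src1 D N) X"
    and cMN: "\<And>N. \<lbrakk>N \<in> Obj (D1 D); tgt1 D N = X\<rbrakk> \<Longrightarrow>
      square_coproduct (\<lambda>n. (M \<odot> P n) \<odot> N) ((M \<odot> T) \<odot> N)
        (\<lambda>n. (hid D M \<circledast> \<iota> n) \<circledast> hid D N) (src1 D N) X"
  proof (rule stable_coproduct[OF fib stab X X, of P])
    fix T \<iota>
    assume "square_coproduct P T \<iota> X X"
      and cM: "\<And>M. \<lbrakk>M \<in> Obj (D1 D); src1 D M = X\<rbrakk> \<Longrightarrow>
        square_coproduct (\<lambda>n. M \<odot> P n) (M \<odot> T) (\<lambda>n. hid D M \<circledast> \<iota> n) X (tgt1 D M)"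
      and "\<And>N. \<lbrakk>N \<in> Obj (D1 D); tgt1 D N = X\<rbrakk> \<Longrightarrow>
        square_coproduct (\<lambda>n. P n \<odot> N) (T \<odot> N) (\<lambda>n. \<iota> n \<circledast> hid D N) (src1 D N) X"
      and cMN: "\<And>M N. \<lbrakk>M \<in> Obj (D1 D); src1 D M = X; N \<in> Obj (D1 D); tgt1 D N = X\<rbrakk> \<Longrightarrow>
        square_coproduct (\<lambda>n. (M \<odot> P n) \<odot> N) ((M \<odot> T) \<odot> N)
          (\<lambda>n. (hid D M \<circledast> \<iota> n) \<circledast> hid D N) (src1 D N) (tgt1 D M)"
    thus thesis
      using that[of T \<iota>] cM[of M] cMN[of M] M by simp
  qed simp_all
  have iota: "square (\<iota> n) (P n) T (Idn (D0 D) X) (Idn (D0 D) X)" for n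
    using c by (simp add: square_coproduct_def)
  note [simp] = globular_squareD[OF iota X X]
  obtain a where a: "square a (M \<odot> T) T (Idn (D0 D) X) (Idn (D0 D) X)"
    and a_iota: "\<And>n. a \<bullet> (hid D M \<circledast> \<iota> n) = \<iota> (Suc n)"
  proof -
    have "\<forall>n. square (\<iota> (Suc n)) (M \<odot> P n) T (Idn (D0 D) X) (Idn (D0 D) X)"
      using iota[of "Suc _"] by simp
    thus thesis
      using cM[unfolded square_coproduct_def, THEN conjunct2, rule_format, of "\<lambda>n. \<iota> (Suc n)"] that by blast
  qed
  note [simp] = globular_squareD(1-5)[OF a X X]
  have "free_action D X M T (\<iota> 0) a"
  proof
    show "square (\<iota> 0) (hunit1 D X) T (Idn (D0 D) X) (Idn (D0 D) X)" using iota[of 0] by simp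
    show "square a (M \<odot> T) T (Idn (D0 D) X) (Idn (D0 D) X)" by (rule a)
  next
    fix N \<alpha> B f z Z v b
    assume N: "N \<in> Obj (D1 D)" "tgt1 D N = X" and al: "square \<alpha> M B f f" and z: "square z N Z v f"
      and b: "square b (B \<odot> Z) Z (Idn (D0 D) (Cod (D0 D) v)) (Idn (D0 D) (Cod (D0 D) f))"
    have f: "Dom (D0 D) f = X" using squareD(10)[OF al] by simp
    note [simp] = N squareD[OF al] squareD[OF z] squareD(1-5)[OF b] f
    define \<kappa> where "\<kappa> = rec_nat (z \<bullet> LUnit D N) (\<lambda>n k. b \<bullet> (\<alpha> \<circledast> k) \<bullet> Assoc D M (P n) N)"
    have k0: "\<kappa> 0 = z \<bullet> LUnit D N" and kS: "\<kappa> (Suc n) = b \<bullet> (\<alpha> \<circledast> \<kappa> n) \<bullet> Assoc D M (P n) N" for n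
      by (simp_all add: \<kappa>_def)
    have kap: "square (\<kappa> n) (P n \<odot> N) Z v f" for n
    proof (induction n)
      case 0 thus ?case by (simp add: k0 square_iff)
    next
      case (Suc n)
      note [simp] = squareD(1-5)[OF Suc]
      show ?case by (simp add: kS square_iff)
    qed
    have conv: "(\<forall>n. k \<bullet> (\<iota> n \<circledast> hid D N) = \<kappa> n) \<longleftrightarrow>
        k \<bullet> (\<iota> 0 \<circledast> hid D N) = z \<bullet> LUnit D N \<and> k \<bullet> (a \<circledast> hid D N) = b \<bullet> (\<alpha> \<circledast> k) \<bullet> Assoc D M T N"
      (is "?L \<longleftrightarrow> ?R") if k: "square k (T \<odot> N) Z v f" for k
    proof -
      note [simp] = squareD(1-5)[OF k]
      have l: "(k \<bullet> (a \<circledast> hid D N)) \<bullet> ((hid D M \<circledast> \<iota> n) \<circledast> hid D N) = k \<bullet> (\<iota> (Suc n) \<circledast> hid D N)" for n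
        by (simp add: H.assoc_Arr interchange a_iota)
      have r: "(b \<bullet> (\<alpha> \<circledast> k) \<bullet> Assoc D M T N) \<bullet> ((hid D M \<circledast> \<iota> n) \<circledast> hid D N) =
          b \<bullet> (\<alpha> \<circledast> (k \<bullet> (\<iota> n \<circledast> hid D N))) \<bullet> Assoc D M (P n) N" for n
        by (simp add: H.assoc_Arr Assoc_slide interchange_rest)
      show ?thesis
      proof
        assume L: ?L
        have "k \<bullet> (a \<circledast> hid D N) = b \<bullet> (\<alpha> \<circledast> k) \<bullet> Assoc D M T N"
        proof (rule square_coproduct_eqI[OF cMN[OF N]])
          show "(k \<bullet> (a \<circledast> hid D N)) \<bullet> ((hid D M \<circledast> \<iota> n) \<circledast> hid D N) =
              (b \<bullet> (\<alpha> \<circledast> k) \<bullet> Assoc D M T N) \<bullet> ((hid D M \<circledast> \<iota> n) \<circledast> hid D N)" for n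
            unfolding l r using L by (simp add: kS)
          show "square (k \<bullet> (a \<circledast> hid D N)) ((M \<odot> T) \<odot> N) Z v f"
            "square (b \<bullet> (\<alpha> \<circledast> k) \<bullet> Assoc D M T N) ((M \<odot> T) \<odot> N) Z v f"
            by (simp_all add: square_iff)
        qed (use N in auto)
        thus ?R using L k0 by simp
      next
        assume R: ?R
        have "k \<bullet> (\<iota> n \<circledast> hid D N) = \<kappa> n" for n
        proof (induction n)
          case 0 thus ?case using R k0 by simp
        next
          case (Suc n)
          show ?case unfolding kS Suc[symmetric] r[symmetric] l[symmetric] using R by simp
        qed
        thus ?L by blast
      qed
    qed
    have "\<exists>!k. square k (T \<odot> N) Z v f \<and> (\<forall>n. k \<bullet> (\<iota> n \<circledast> hid D N) = \<kappa> n)"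
      using cN[OF N] kap unfolding square_coproduct_def by blast
    thus "\<exists>!k. square k (T \<odot> N) Z v f \<and> k \<bullet> (\<iota> 0 \<circledast> hid D N) = z \<bullet> LUnit D N \<and>
        k \<bullet> (a \<circledast> hid D N) = b \<bullet> (\<alpha> \<circledast> k) \<bullet> Assoc D M T N"
      using conv by (metis (no_types, lifting))
  qed simp_all
  thus ?thesis by blast
qed

section \<open>The left adjoint\<close>

lemma universal_arrow_to_monads:
  assumes fib: "fibrant D" and stab: "stable_local_countable_coproducts D" and M: "M \<in> Obj (End_cat D)"
  shows "\<exists>F u. F \<in> Obj (Mnd_cat D) \<and> in_hom (End_cat D) u M (omap (forget_mnd D) F) \<and>
    (\<forall>S\<in>Obj (Mnd_cat D). \<forall>g. in_hom (End_cat D) g M (omap (forget_mnd D) S) \<longrightarrow>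
      (\<exists>!h. in_hom (Mnd_cat D) h F S \<and> amap (forget_mnd D) h \<cdot>\<^bsub>End_cat D\<^esub> u = g))"
proof -
  define X where "X = src1 D M"
  have "\<exists>T e a. free_action D X M T e a"
    by (rule free_action_exists[OF fib stab]) (use M in \<open>simp_all add: X_def\<close>)
  then obtain T e a where "free_action D X M T e a" by blast
  then interpret free_action D X M T e a .
  obtain u where u: "square u M T (Idn (D0 D) X) (Idn (D0 D) X)"
    "u \<bullet> RUnit D M = a \<bullet> (hid D M \<circledast> e)"
    by (rule generator_exists)
  have "\<exists>!h. in_hom (Mnd_cat D) h free_monad S \<and> amap (forget_mnd D) h \<cdot>\<^bsub>End_cat D\<^esub> u = g"
    if S: "is_monad D S" and g: "in_hom (End_cat D) g M (und S)" for S g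
  proof -
    have "square g M (und S) (src2 D g) (src2 D g)"
      using g by (simp add: in_hom_def square_iff)
    from free_monad_universal[OF u S this]
    obtain h where h: "is_monad_morphism D free_monad h S" "h \<bullet> u = g"
      and uniq: "\<And>h'. is_monad_morphism D free_monad h' S \<Longrightarrow> h' \<bullet> u = g \<Longrightarrow> h' = h" by blast
    show ?thesis
    proof (rule ex1I[of _ "(free_monad, h, S)"])
      show "in_hom (Mnd_cat D) (free_monad, h, S) free_monad S \<and>
          amap (forget_mnd D) (free_monad, h, S) \<cdot>\<^bsub>End_cat D\<^esub> u = g"
        using h S is_monad_free_monad by (simp add: in_hom_def forget_mnd_def)
    next
      fix k assume k: "in_hom (Mnd_cat D) k free_monad S \<and> amap (forget_mnd D) k \<cdot>\<^bsub>End_cat D\<^esub> u = g"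
      obtain S1 h' S2 where "k = (S1, h', S2)" by (cases k)
      with k uniq show "k = (free_monad, h, S)" by (auto simp: in_hom_def forget_mnd_def)
    qed
  qed
  moreover have "in_hom (End_cat D) u M T"
    using u(1) by (simp add: square_iff in_hom_def)
  ultimately show ?thesis
    using is_monad_free_monad
    by (intro exI[of _ free_monad] exI[of _ u]) (simp add: forget_mnd_def)
qed

end

theorem proposition3p1:
  fixes D :: "('o, 'v, 'h, 'c) double_cat"
  assumes "double_category D"
    and "fibrant D"
    and "stable_local_countable_coproducts D"
  shows "has_left_adjoint (Mnd_cat D) (End_cat D) (forget_mnd D)"
proof -
  interpret double_category D by fact
  show ?thesis
    by (rule left_adjoint_from_universal_arrows[OF is_functor_forget_mnd
        universal_arrow_to_monads[OF assms(2,3)]])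
qed

end
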